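(* Let $\mathcal{V}\subset\operatorname{lsc-fcns}(\mathcal{X})$ satisfy the following regularity assumption: for each $V\in\mathcal{V}$ and $x\in\mathcal{X}$ the function $b(V)(x,\cdot)$ is integrable with respect to $\mathbb{P}$ and $B$ maps $\mathcal{V}$ into itself; moreover, for each $\nu\in\mathbb{N}$, for each $V\in\mathcal{V}$ and $x\in\mathcal{X}$ the function $b_\nu(V)(x,\cdot)$ is integrable with respect to $\mathbb{P}_\nu$ and $B_\nu$ maps $\mathcal{V}$ into itself. Suppose that $\mathbb{P}_\nu\Rightarrow\mathbb{P}$ (weak convergence), $\varphi_\nu\overset{\mathrm{e}}{\to}\varphi$, and $\varphi_\nu\overset{\mathrm{p}}{\to}\varphi$, and that $\mathcal{V}$ is compact (hence closed) under the Attouch--Wets distance $d\!\!l$. Suppose that every epi-convergent sequence $\{W_\nu\in\mathcal{V}\}_{\nu\in\mathbb{N}}$ is equi-lsc and satisfies the following two conditions for each $\bar x\in\mathcal{X}$: (a) $\displaystyle\liminf_{\tau\to-\infty}\ \liminf_{(\nu,x)\to(\infty,\bar x)}\ \mathbb{E}_{\mathbb{P}_\nu}\bigl[b_\nu(W_\nu)(x,\boldsymbol{\xi})\,\mathbb{1}\{b_\nu(W_\nu)(x,\boldsymbol{\xi})\le\tau\}\bigr]=0$, and $\{b_\nu(W_\nu)\}_{\nu\in\mathbb{N}}$ is a sequence of lsc functions on $\mathcal{X}\times\Xi$ that is equi-lsc; (b) $\displaystyle\limsup_{\tau\to\infty}\ \limsup_{\nu\to\infty}\ \mathbb{E}_{\mathbb{P}_\nu}\bigl[b_\nu(W_\nu)(\bar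 x,\boldsymbol{\xi})\,\mathbb{1}\{b_\nu(W_\nu)(\bar x,\boldsymbol{\xi})\ge\tau\}\bigr]=0$, and $\{b_\nu(W_\nu)(\bar x,\cdot)\}_{\nu\in\mathbb{N}}$ is a sequence of usc functions on $\Xi$ that is equi-usc. Suppose finally that each $B_\nu$ has a fixed point $V_\nu=B_\nu(V_\nu)$ in $\mathcal{V}$, and consider the sequence $\{V_\nu\}_{\nu\in\mathbb{N}}$. Then the following are true: (i) If $V_{\nu_\kappa}\overset{\mathrm{e}}{\to}V$ is an epi-convergent subsequence of $\{V_\nu\}_{\nu\in\mathbb{N}}$, then $V=B(V)$ and, for all $(x,\xi)\in\mathcal{X}\times\Xi$, $$\operatorname{LimOut}\Bigl(\operatorname*{argmin}_{y\in\mathcal{Y}(x,\xi)}\bigl\{\varphi_{\nu_\kappa}(x,y,\xi)+\beta V_{\nu_\kappa}(y)\bigr\}\Bigr)\subset\operatorname*{argmin}_{y\in\mathcal{Y}(x,\xi)}\bigl\{\varphi(x,y,\xi)+\beta V(y)\bigr\}\neq\varnothing .$$ (ii) If the fixed point $V=B(V)$ of $B$ in $\mathcal{V}$ is unique, then, for all $(x,\xi)\in\mathcal{X}\times\Xi$, $$\operatorname{LimOut}\Bigl(\operatorname*{argmin}_{y\in\mathcal{Y}(x,\xi)}\bigl\{\varphi_{\nu}(x,y,\xi)+\beta V_{\nu}(y)\bigr\}\Bigr)\subset\operatorname*{argmin}_{y\in\mathcal{Y}(x,\xi)}\bigl\{\varphi(x,y,\xi)+\beta V(y)\bigr\}\neq\varnothing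 .$$
   Context: Setting. $\mathcal{X}\subset\mathbb{R}^n$ (state space) and $\Xi\subset\mathbb{R}^m$ (outcome space) are closed sets; $\beta\in(0,1)$; $\mathcal{Y}:\mathcal{X}\times\Xi\rightrightarrows\mathcal{X}$ is a set-valued mapping with nonempty compact values; $\varphi,\varphi_\nu:\mathcal{X}\times\mathcal{X}\times\Xi\to\mathbb{R}$ ($\nu\in\mathbb{N}$) are functions; $\mathbb{P},\mathbb{P}_\nu$ ($\nu\in\mathbb{N}$) are Borel probability distributions on $\Xi$. $\mathbb{E}_{\mathbb{P}}[f(\boldsymbol{\xi})]=\int_\Xi f(\xi)\,d\mathbb{P}(\xi)$, and $\mathbb{1}\{\mathcal{E}\}$ is $1$ if $\mathcal{E}$ is true and $0$ otherwise. Function classes. For a closed set $\mathcal{Z}\subset\mathbb{R}^r$, $\operatorname{fcns}(\mathcal{Z})$ is the set of functions $\mathcal{Z}\to[-\infty,\infty]$ other than the constant function $\infty$, and $\operatorname{lsc-fcns}(\mathcal{Z})$ is its subset of lower semicontinuous (lsc) functions; usc means upper semicontinuous. Bellman operators. For $f\in\operatorname{lsc-fcns}(\mathcal{X})$, $$b(f)(x,\xi)=\inf_{y\in\mathcal{Y}(x,\xi)}\{\varphi(x,y,\xi)+\beta f(y)\},\qquad B(f)(x)=\mathbb{E}_{\mathbb{P}}[b(f)(x,\boldsymbol{\xi})],$$ $$b_\nu(f)(x,\xi)=\inf_{y\in\mathcal{Y}(x,\xi)}\{\varphi_\nu(x,y,\xi)+\beta f(y)\},\qquad B_\nu(f)(x)=\mathbb{E}_{\mathbb{P}_\nu}[b_\nu(f)(x,\boldsymbol{\xi})].$$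 Convergence. For $f,f_\nu\in\operatorname{fcns}(\mathcal{Z})$: $f_\nu\overset{\mathrm{p}}{\to}f$ means pointwise convergence; $f_\nu\overset{\mathrm{e}}{\to}f$ (epi-convergence) means that for each $z\in\mathcal{Z}$, every sequence $z_\nu\in\mathcal{Z}\to z$ satisfies $\liminf f_\nu(z_\nu)\ge f(z)$, and some sequence $z_\nu\in\mathcal{Z}\to z$ satisfies $\limsup f_\nu(z_\nu)\le f(z)$. Equi-semicontinuity. A sequence $f_\nu\in\operatorname{lsc-fcns}(\mathcal{Z})$ is equi-lsc if for every $\bar z\in\mathcal{Z}$ either $f_\nu(\bar z)\to-\infty$, or for each $\rho,\varepsilon\in(0,\infty)$ there exist $\bar\nu\in\mathbb{N}$ and $\delta>0$ such that $\inf_{z\in\mathcal{Z},\|z-\bar z\|_2\le\delta}f_\nu(z)\ge\min\{f_\nu(\bar z)-\varepsilon,\rho\}$ for all $\nu\ge\bar\nu$. A sequence of usc functions $f_\nu$ is equi-usc if $\{-f_\nu\}$ is equi-lsc. Attouch--Wets distance. Fix $z_{\mathrm{ctr}}\in\mathcal{X}\times\mathbb{R}$. For $f,g\in\operatorname{lsc-fcns}(\mathcal{X})$, $$d\!\!l(f,g)=\int_0^\infty\max_{z\in\mathcal{X}\times\mathbb{R},\,\|z-z_{\mathrm{ctr}}\|_2\le\rho}\bigl|\operatorname{dist}(z,\operatorname{epi}f)-\operatorname{dist}(z,\operatorname{epi}g)\bigr|\,e^{-\rho}\,d\rho,$$ where $\operatorname{epi}f=\{(x,\tau)\in\mathcal{X}\times\mathbb{R}:f(x)\le\tau\}$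 and $\operatorname{dist}$ is the Euclidean point-to-set distance. This is a metric on $\operatorname{lsc-fcns}(\mathcal{X})$ and $f_\nu\overset{\mathrm{e}}{\to}f$ if and only if $d\!\!l(f_\nu,f)\to0$. The expression $V=B(V)$ means $d\!\!l(V,B(V))=0$, equivalently pointwise equality on $\mathcal{X}$. The limit $(\nu,x)\to(\infty,\bar x)$ means $\nu\to\infty$ in $\mathbb{N}$ and $x\to\bar x$ with $x\in\mathcal{X}$. For sets $S_\nu$, $\operatorname{LimOut}(S_\nu)$ (outer limit) is the set of all points $z$ for which there are a subsequence $\nu_1<\nu_2<\cdots$ of the index sequence and $z_\kappa\in S_{\nu_\kappa}$ with $z_\kappa\to z$. *)

theory Defs
  imports "HOL-Probability.Probability"
begin

section \<open>Extended-real-valued functions on a set\<close>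

text \<open>A function on a set \<open>Z\<close> is represented by its extensional total function, so that equality in
  HOL is equality on \<open>Z\<close>. The predicates \<open>lsc_on\<close>, \<open>usc_on\<close>, \<open>epi_conv\<close>, \<open>equi_lsc\<close> and \<open>equi_usc\<close>
  inspect their arguments on \<open>Z\<close> only and therefore do not ask for extensionality.\<close>

definition fcns :: "'a set \<Rightarrow> ('a \<Rightarrow> ereal) set" where
  "fcns Z = {f \<in> extensional Z. \<not> (\<forall>z\<in>Z. f z = \<infinity>)}"

definition lsc_on :: "'a::topological_space set \<Rightarrow> ('a \<Rightarrow> ereal) \<Rightarrow> bool" where
  "lsc_on Z f \<longleftrightarrow> (\<forall>z\<in>Z. f z \<le> Liminf (at z within Z) f)"

definition usc_on :: "'a::topological_space set \<Rightarrow> ('a \<Rightarrow> ereal) \<Rightarrow> bool" where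
  "usc_on Z f \<longleftrightarrow> (\<forall>z\<in>Z. Limsup (at z within Z) f \<le> f z)"

definition lsc_fcns :: "'a::topological_space set \<Rightarrow> ('a \<Rightarrow> ereal) set" where
  "lsc_fcns Z = {f \<in> fcns Z. lsc_on Z f}"

definition epi_conv ::
  "'a::topological_space set \<Rightarrow> (nat \<Rightarrow> 'a \<Rightarrow> ereal) \<Rightarrow> ('a \<Rightarrow> ereal) \<Rightarrow> bool" where
  "epi_conv Z fs f \<longleftrightarrow> (\<forall>z\<in>Z.
     (\<forall>w. (\<forall>\<nu>. w \<nu> \<in> Z) \<and> w \<longlonglongrightarrow> z \<longrightarrow> liminf (\<lambda>\<nu>. fs \<nu> (w \<nu>)) \<ge> f z) \<and>
     (\<exists>w. (\<forall>\<nu>. w \<nu> \<in> Z) \<and> w \<longlonglongrightarrow> z \<and> limsup (\<lambda>\<nu>. fs \<nu> (w \<nu>)) \<le> f z))"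

definition equi_lsc :: "'a::metric_space set \<Rightarrow> (nat \<Rightarrow> 'a \<Rightarrow> ereal) \<Rightarrow> bool" where
  "equi_lsc Z fs \<longleftrightarrow> (\<forall>zb\<in>Z.
     (\<lambda>\<nu>. fs \<nu> zb) \<longlonglongrightarrow> - \<infinity> \<or>
     (\<forall>\<rho>>0. \<forall>\<epsilon>>0. \<exists>\<nu>b. \<exists>\<delta>>0. \<forall>\<nu>\<ge>\<nu>b.
        (INF z\<in>{z\<in>Z. dist z zb \<le> \<delta>}. fs \<nu> z) \<ge> min (fs \<nu> zb - ereal \<epsilon>) (ereal \<rho>)))"

definition equi_usc :: "'a::metric_space set \<Rightarrow> (nat \<Rightarrow> 'a \<Rightarrow> ereal) \<Rightarrow> bool" where
  "equi_usc Z fs \<longleftrightarrow> equi_lsc Z (\<lambda>\<nu> z. - fs \<nu> z)"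

section \<open>The Attouch--Wets distance\<close>

definition epi :: "'a set \<Rightarrow> ('a \<Rightarrow> ereal) \<Rightarrow> ('a \<times> real) set" where
  "epi X f = {(x, \<tau>). x \<in> X \<and> f x \<le> ereal \<tau>}"

text \<open>For closed \<open>X\<close> the supremum below is that of a continuous function over a compact set, hence a
  maximum.\<close>

definition aw_dist ::
  "'a::euclidean_space set \<Rightarrow> 'a \<times> real \<Rightarrow> ('a \<Rightarrow> ereal) \<Rightarrow> ('a \<Rightarrow> ereal) \<Rightarrow> real" where
  "aw_dist X zctr f g =
     (LBINT \<rho>:{0..}. (SUP z\<in>{z \<in> X \<times> UNIV. dist z zctr \<le> \<rho>}.
        \<bar>infdist z (epi X f) - infdist z (epi X g)\<bar>) * exp (- \<rho>))"

section \<open>Expectations and weak convergence\<close>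

text \<open>Bochner integration in the library does not cover extended-real-valued integrands.\<close>

definition ereal_integrable :: "'a measure \<Rightarrow> ('a \<Rightarrow> ereal) \<Rightarrow> bool" where
  "ereal_integrable M f \<longleftrightarrow> f \<in> borel_measurable M \<and> (\<integral>\<^sup>+ x. e2ennreal \<bar>f x\<bar> \<partial>M) < \<infinity>"

text \<open>The map \<open>e2ennreal\<close> sends negative numbers to \<open>0\<close>, so the two terms are the integrals of the
  positive and negative parts.\<close>

definition ereal_expect :: "'a measure \<Rightarrow> ('a \<Rightarrow> ereal) \<Rightarrow> ereal" where
  "ereal_expect M f =
     enn2ereal (\<integral>\<^sup>+ x. e2ennreal (f x) \<partial>M) - enn2ereal (\<integral>\<^sup>+ x. e2ennreal (- f x) \<partial>M)"

definition borel_prob_on :: "'a::topological_space set \<Rightarrow> 'a measure \<Rightarrow> bool" where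
  "borel_prob_on S P \<longleftrightarrow> prob_space P \<and> sets P = sets (restrict_space borel S)"

definition weak_conv_on ::
  "'a::topological_space set \<Rightarrow> (nat \<Rightarrow> 'a measure) \<Rightarrow> 'a measure \<Rightarrow> bool" where
  "weak_conv_on S Ps P \<longleftrightarrow> (\<forall>g::'a \<Rightarrow> real. continuous_on S g \<and> bounded (g ` S) \<longrightarrow>
     (\<lambda>\<nu>. \<integral>\<xi>. g \<xi> \<partial>Ps \<nu>) \<longlonglongrightarrow> (\<integral>\<xi>. g \<xi> \<partial>P))"

section \<open>Bellman operators\<close>

definition bellman_obj ::
  "real \<Rightarrow> ('a \<times> 'a \<times> 'b \<Rightarrow> real) \<Rightarrow> ('a \<Rightarrow> ereal) \<Rightarrow> 'a \<Rightarrow> 'b \<Rightarrow> 'a \<Rightarrow> ereal" where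
  "bellman_obj \<beta> \<phi> f x \<xi> y = ereal (\<phi> (x, y, \<xi>)) + ereal \<beta> * f y"

definition bellman_inf ::
  "real \<Rightarrow> ('a \<times> 'a \<times> 'b \<Rightarrow> real) \<Rightarrow> ('a \<Rightarrow> 'b \<Rightarrow> 'a set) \<Rightarrow> ('a \<Rightarrow> ereal) \<Rightarrow> 'a \<Rightarrow> 'b \<Rightarrow> ereal" where
  "bellman_inf \<beta> \<phi> Y f x \<xi> = (INF y\<in>Y x \<xi>. bellman_obj \<beta> \<phi> f x \<xi> y)"

definition bellman ::
  "'a set \<Rightarrow> 'b measure \<Rightarrow> real \<Rightarrow> ('a \<times> 'a \<times> 'b \<Rightarrow> real) \<Rightarrow> ('a \<Rightarrow> 'b \<Rightarrow> 'a set) \<Rightarrow>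
     ('a \<Rightarrow> ereal) \<Rightarrow> ('a \<Rightarrow> ereal)" where
  "bellman X P \<beta> \<phi> Y f = (\<lambda>x\<in>X. ereal_expect P (\<lambda>\<xi>. bellman_inf \<beta> \<phi> Y f x \<xi>))"

section \<open>Minimizers and outer limits\<close>

definition argmin_on :: "'a set \<Rightarrow> ('a \<Rightarrow> ereal) \<Rightarrow> 'a set" where
  "argmin_on C f = {y. is_arg_min f (\<lambda>y. y \<in> C) y}"

definition LimOut :: "(nat \<Rightarrow> 'a::topological_space set) \<Rightarrow> 'a set" where
  "LimOut S = {z. \<exists>r w. strict_mono (r :: nat \<Rightarrow> nat) \<and> (\<forall>k. w k \<in> S (r k)) \<and> w \<longlonglongrightarrow> z}"

end

theory Submission
  imports Defs
begin

text \<open>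
  Why the theorem holds. Everything is phrased with one notion, \<open>lower_limit\<close>: near each point, and
  uniformly in the tail of the sequence, the functions stay above every number below the value of the
  limit there. It is the lower half of epi-convergence (\<open>epi_conv_imp_lower_limit\<close>), and it follows
  from equi-lower semicontinuity together with pointwise convergence (\<open>equi_lsc_imp_lower_limit\<close>).

  Let \<open>V\<close> be the epi-limit of a subsequence of the fixed points. The set \<open>\<V>\<close> is compact for the
  Attouch--Wets metric and convergence in this metric implies epi-convergence
  (\<open>aw_convergence_imp_epi_conv\<close>), so uniqueness of epi-limits puts \<open>V\<close> into \<open>\<V>\<close>. The hypotheses on
  epi-convergent sequences pair the \<open>\<nu>\<close>-th function with the \<open>\<nu>\<close>-th operator, so they cannot be
  applied to a subsequence directly; filling the gaps of the subsequence with \<open>V\<close> gives a full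
  sequence \<open>W\<close> in \<open>\<V>\<close> that still epi-converges to \<open>V\<close> (\<open>epi_conv_interleave\<close>). Being equi-lsc, it
  also converges pointwise (\<open>equi_lsc_epi_conv_imp_pointwise\<close>). Hence, on the compact set
  \<open>Y x \<xi>\<close>, the Bellman objectives converge pointwise and with lower limits. This yields convergence of
  the minimal values, existence of minimizers of the limit, and that limits of minimizers are
  minimizers (\<open>tendsto_INF_compact\<close>, \<open>argmin_on_nonempty\<close>, \<open>LimOut_argmin_subset\<close>).

  It remains to see that \<open>V = B(V)\<close>. Fix \<open>x\<close>. The minimal values \<open>b\<^sub>\<nu>(W\<^sub>\<nu>)(x, \<cdot>)\<close> converge
  pointwise on \<open>\<Xi>\<close> and are equi-lsc and equi-usc, so they converge continuously, that is, jointly in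
  \<open>\<nu>\<close> and \<open>\<xi>\<close>. After clamping the values to \<open>[-T, T]\<close>, continuous convergence is uniform on compact
  sets, and weak convergence controls the mass far out, so the expectations converge
  (\<open>bounded_expectation_limit\<close>). The conditions on the expectations over large negative and large
  positive values make the clamping error uniformly small (\<open>expectation_limit\<close>). Thus
  \<open>V\<^sub>\<nu>(x) = B\<^sub>\<nu>(V\<^sub>\<nu>)(x)\<close> converges along the subsequence both to \<open>V(x)\<close> and to \<open>B(V)(x)\<close>.

  For a unique fixed point, any limit of minimizers is taken along some subsequence; by compactness
  that subsequence can be thinned out so that the fixed points epi-converge, and by the first part
  their limit is the unique fixed point of \<open>B\<close>.
\<close>

section \<open>Lower limits of sequences of functions\<close>

text \<open>The filter of pairs \<open>(\<nu>, w)\<close> with \<open>\<nu>\<close> tending to infinity and \<open>w\<close> tending to \<open>z\<close> inside \<open>Z\<close>, the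
  point \<open>w = z\<close> itself being allowed.\<close>

definition joint_filter :: "'a::metric_space \<Rightarrow> 'a set \<Rightarrow> (nat \<times> 'a) filter" where
  "joint_filter z Z = sequentially \<times>\<^sub>F inf (nhds z) (principal Z)"

lemma eventually_joint_filter:
  "eventually P (joint_filter z Z) \<longleftrightarrow>
    (\<exists>N. \<exists>\<delta>>0. \<forall>\<nu>\<ge>N. \<forall>w\<in>Z. dist w z < \<delta> \<longrightarrow> P (\<nu>, w))"
proof
  assume "eventually P (joint_filter z Z)"
  then obtain A B where "eventually A sequentially" "eventually B (inf (nhds z) (principal Z))"
    and AB: "\<And>\<nu> w. A \<nu> \<Longrightarrow> B w \<Longrightarrow> P (\<nu>, w)"
    unfolding joint_filter_def eventually_prod_filter by blast
  then show "\<exists>N. \<exists>\<delta>>0. \<forall>\<nu>\<ge>N. \<forall>w\<in>Z. dist w z < \<delta> \<longrightarrow> P (\<nu>, w)"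
    unfolding eventually_sequentially eventually_inf_principal eventually_nhds_metric by meson
next
  assume "\<exists>N. \<exists>\<delta>>0. \<forall>\<nu>\<ge>N. \<forall>w\<in>Z. dist w z < \<delta> \<longrightarrow> P (\<nu>, w)"
  then obtain N \<delta> where "\<delta> > 0" and P: "\<And>\<nu> w. \<nu> \<ge> N \<Longrightarrow> w \<in> Z \<Longrightarrow> dist w z < \<delta> \<Longrightarrow> P (\<nu>, w)"
    by blast
  then have "eventually (\<lambda>w. w \<in> Z \<and> dist w z < \<delta>) (inf (nhds z) (principal Z))"
    unfolding eventually_inf_principal eventually_nhds_metric by blast
  then show "eventually P (joint_filter z Z)"
    unfolding joint_filter_def eventually_prod_filter
    using P eventually_ge_at_top[of N] by blast
qed

text \<open>This says \<open>f z \<le> Liminf (joint_filter z Z) (\<lambda>(\<nu>, w). fs \<nu> w)\<close> for \<open>z\<close> in \<open>Z\<close>. The explicit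
  thresholds \<open>N\<close> and \<open>\<delta>\<close> are what the compactness arguments below consume.\<close>

definition lower_limit :: "'a::metric_space set \<Rightarrow> (nat \<Rightarrow> 'a \<Rightarrow> ereal) \<Rightarrow> ('a \<Rightarrow> ereal) \<Rightarrow> bool" where
  "lower_limit Z fs f \<longleftrightarrow>
    (\<forall>z\<in>Z. \<forall>a<f z. \<exists>N. \<exists>\<delta>>0. \<forall>\<nu>\<ge>N. \<forall>w\<in>Z. dist w z < \<delta> \<longrightarrow> a < fs \<nu> w)"

lemma lower_limitD:
  assumes "lower_limit Z fs f" "z \<in> Z" "a < f z"
  obtains N \<delta> where "\<delta> > 0" "\<And>\<nu> w. \<nu> \<ge> N \<Longrightarrow> w \<in> Z \<Longrightarrow> dist w z < \<delta> \<Longrightarrow> a < fs \<nu> w"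
  using assms unfolding lower_limit_def by meson

lemma lower_limit_subseq:
  assumes "lower_limit Z fs f" "strict_mono r"
  shows "lower_limit Z (\<lambda>k. fs (r k)) f"
  unfolding lower_limit_def
proof (intro ballI allI impI)
  fix z a assume "z \<in> Z" "a < f z"
  with assms(1) obtain N \<delta> where "\<delta> > 0"
    and N: "\<And>\<nu> w. \<nu> \<ge> N \<Longrightarrow> w \<in> Z \<Longrightarrow> dist w z < \<delta> \<Longrightarrow> a < fs \<nu> w"
    by (rule lower_limitD) blast
  moreover have "r k \<ge> N" if "k \<ge> N" for k
    using that seq_suble[OF assms(2), of k] by simp
  ultimately show "\<exists>N. \<exists>\<delta>>0. \<forall>k\<ge>N. \<forall>w\<in>Z. dist w z < \<delta> \<longrightarrow> a < fs (r k) w"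
    by blast
qed

lemma lower_limit_liminf:
  assumes "lower_limit Z fs f" "z \<in> Z" "\<And>\<nu>. w \<nu> \<in> Z" "w \<longlonglongrightarrow> z"
  shows "f z \<le> liminf (\<lambda>\<nu>. fs \<nu> (w \<nu>))"
  unfolding le_Liminf_iff
proof (intro allI impI)
  fix a assume "a < f z"
  with assms(1,2) obtain N \<delta> where "\<delta> > 0"
    and N: "\<And>\<nu> w. \<nu> \<ge> N \<Longrightarrow> w \<in> Z \<Longrightarrow> dist w z < \<delta> \<Longrightarrow> a < fs \<nu> w"
    by (rule lower_limitD) blast
  have "\<forall>\<^sub>F \<nu> in sequentially. dist (w \<nu>) z < \<delta>"
    using assms(4) \<open>\<delta> > 0\<close> by (rule tendstoD)
  with eventually_ge_at_top[of N] show "\<forall>\<^sub>F \<nu> in sequentially. a < fs \<nu> (w \<nu>)"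
    by eventually_elim (use N assms(3) in blast)
qed

text \<open>Lower limits of \<open>fs\<close> and of \<open>- fs\<close> are the two order halves of continuous convergence.\<close>

lemma lower_limit_tendsto_joint:
  assumes "lower_limit Z fs f" "lower_limit Z (\<lambda>\<nu> z. - fs \<nu> z) (\<lambda>z. - f z)" "z \<in> Z"
  shows "((\<lambda>(\<nu>, w). fs \<nu> w) \<longlongrightarrow> f z) (joint_filter z Z)"
proof (rule order_tendstoI)
  fix a assume "a < f z"
  with assms(1,3) show "\<forall>\<^sub>F p in joint_filter z Z. a < (case p of (\<nu>, w) \<Rightarrow> fs \<nu> w)"
    unfolding lower_limit_def eventually_joint_filter by simp
next
  fix a assume "f z < a"
  then have "- a < - f z" by simp
  with assms(2,3) have "\<exists>N. \<exists>\<delta>>0. \<forall>\<nu>\<ge>N. \<forall>w\<in>Z. dist w z < \<delta> \<longrightarrow> - a < - fs \<nu> w"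
    unfolding lower_limit_def by blast
  then show "\<forall>\<^sub>F p in joint_filter z Z. (case p of (\<nu>, w) \<Rightarrow> fs \<nu> w) < a"
    unfolding eventually_joint_filter by simp
qed

text \<open>Equi-lower semicontinuity compares \<open>fs \<nu>\<close> near \<open>z\<close> with its own value at \<open>z\<close>, and pointwise
  convergence compares that value with \<open>f z\<close>. The truncation level \<open>\<rho>\<close> in the definition only has to
  exceed the number below \<open>f z\<close> that is to be beaten.\<close>

lemma equi_lsc_imp_lower_limit:
  assumes equi: "equi_lsc Z fs" and pt: "\<And>z. z \<in> Z \<Longrightarrow> (\<lambda>\<nu>. fs \<nu> z) \<longlonglongrightarrow> f z"
  shows "lower_limit Z fs f"
  unfolding lower_limit_def
proof (intro ballI allI impI)
  fix z a assume z: "z \<in> Z" and a: "a < f z"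
  have not_Minf: "\<not> (\<lambda>\<nu>. fs \<nu> z) \<longlonglongrightarrow> - \<infinity>"
    using LIMSEQ_unique[OF pt[OF z]] a by auto
  from a obtain c1 where c1: "a < ereal c1" "ereal c1 < f z" using ereal_dense2 by blast
  from c1(2) obtain c2 where c2: "ereal c1 < ereal c2" "ereal c2 < f z" using ereal_dense2 by blast
  from equi z not_Minf have equi': "\<forall>\<rho>>0. \<forall>\<epsilon>>0. \<exists>\<nu>b. \<exists>\<delta>>0. \<forall>\<nu>\<ge>\<nu>b.
      min (fs \<nu> z - ereal \<epsilon>) (ereal \<rho>) \<le> (INF w\<in>{w\<in>Z. dist w z \<le> \<delta>}. fs \<nu> w)"
    unfolding equi_lsc_def by auto
  obtain N \<delta> where \<delta>: "\<delta> > 0" and N: "\<And>\<nu>. \<nu> \<ge> N \<Longrightarrow>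
      min (fs \<nu> z - ereal (c2 - c1)) (ereal (max 1 c1)) \<le> (INF w\<in>{w\<in>Z. dist w z \<le> \<delta>}. fs \<nu> w)"
    using equi'[rule_format, of "max 1 c1" "c2 - c1"] c2(1)
      by (auto simp: less_max_iff_disj)
  have "\<forall>\<^sub>F \<nu> in sequentially. ereal c2 < fs \<nu> z"
    using pt[OF z] c2(2) by (rule order_tendstoD)
  then obtain M where M: "\<And>\<nu>. \<nu> \<ge> M \<Longrightarrow> ereal c2 < fs \<nu> z"
    unfolding eventually_sequentially by blast
  have "a < fs \<nu> w" if "\<nu> \<ge> max N M" "w \<in> Z" "dist w z < \<delta>" for \<nu> w
  proof -
    have "ereal c1 \<le> fs \<nu> z - ereal (c2 - c1)"
      using M[of \<nu>] that(1) by (cases "fs \<nu> z") auto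
    then have "ereal c1 \<le> min (fs \<nu> z - ereal (c2 - c1)) (ereal (max 1 c1))"
      by simp
    also have "\<dots> \<le> (INF w\<in>{w\<in>Z. dist w z \<le> \<delta>}. fs \<nu> w)"
      using N that(1) by simp
    also have "\<dots> \<le> fs \<nu> w"
      by (rule INF_lower) (use that in auto)
    finally show ?thesis using c1(1) by simp
  qed
  with \<delta> show "\<exists>N. \<exists>\<delta>>0. \<forall>\<nu>\<ge>N. \<forall>w\<in>Z. dist w z < \<delta> \<longrightarrow> a < fs \<nu> w"
    by blast
qed

section \<open>Epi-convergence\<close>

text \<open>A sequence indexed by a subsequence becomes a full sequence with the same limit when the missing
  terms are replaced by that limit.\<close>

lemma tendsto_spread:
  fixes u :: "nat \<Rightarrow> 'a::metric_space"
  assumes r: "strict_mono (r :: nat \<Rightarrow> nat)" and u: "u \<longlonglongrightarrow> z"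
  shows "(\<lambda>\<nu>. if \<nu> \<in> range r then u (inv r \<nu>) else z) \<longlonglongrightarrow> z"
proof (rule tendstoI)
  fix e :: real assume e: "e > 0"
  with u obtain N where N: "\<And>k. k \<ge> N \<Longrightarrow> dist (u k) z < e"
    by (meson LIMSEQ_def)
  have "dist (if \<nu> \<in> range r then u (inv r \<nu>) else z) z < e" if \<nu>: "\<nu> \<ge> r N" for \<nu>
  proof (cases "\<nu> \<in> range r")
    case True
    then obtain k where k: "\<nu> = r k" by blast
    then have "k \<ge> N" using \<nu> r by (simp add: strict_mono_less_eq)
    then show ?thesis using N k strict_mono_imp_inj_on[OF r] by simp
  qed (use e in auto)
  then show "\<forall>\<^sub>F \<nu> in sequentially. dist (if \<nu> \<in> range r then u (inv r \<nu>) else z) z < e"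
    unfolding eventually_sequentially by blast
qed

text \<open>If the bound failed, there would be points \<open>u k\<close> tending to \<open>z\<close> and indices \<open>r k\<close> with
  \<open>fs (r k) (u k) \<le> a < f z\<close>; spread out over all indices, the \<open>u k\<close> contradict the sequential
  condition.\<close>

lemma epi_conv_imp_lower_limit:
  fixes Z :: "'a::metric_space set"
  assumes epi: "epi_conv Z fs f"
  shows "lower_limit Z fs f"
  unfolding lower_limit_def
proof (intro ballI allI impI, rule ccontr)
  fix z a assume z: "z \<in> Z" and a: "a < f z"
    and no: "\<not> (\<exists>N. \<exists>\<delta>>0. \<forall>\<nu>\<ge>N. \<forall>w\<in>Z. dist w z < \<delta> \<longrightarrow> a < fs \<nu> w)"
  have ex: "\<exists>\<nu> w. \<nu> \<ge> N \<and> w \<in> Z \<and> dist w z < \<delta> \<and> fs \<nu> w \<le> a" if "\<delta> > 0" for N \<delta>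
    using no that by (meson not_le)
  have "\<exists>p :: nat \<Rightarrow> nat \<times> 'a. \<forall>k.
      (snd (p k) \<in> Z \<and> dist (snd (p k)) z < inverse (real (Suc k)) \<and> fs (fst (p k)) (snd (p k)) \<le> a) \<and>
      fst (p k) < fst (p (Suc k))"
  proof (rule dependent_nat_choice)
    show "\<exists>q. snd q \<in> Z \<and> dist (snd q) z < inverse (real (Suc 0)) \<and> fs (fst q) (snd q) \<le> a"
      using ex[of "inverse (real (Suc 0))" 0] by auto
  next
    fix q :: "nat \<times> 'a" and k
    obtain \<nu> w where "\<nu> \<ge> Suc (fst q)" "w \<in> Z" "dist w z < inverse (real (Suc (Suc k)))" "fs \<nu> w \<le> a"
      using ex[of "inverse (real (Suc (Suc k)))" "Suc (fst q)"] by auto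
    then show "\<exists>q'. (snd q' \<in> Z \<and> dist (snd q') z < inverse (real (Suc (Suc k))) \<and>
        fs (fst q') (snd q') \<le> a) \<and> fst q < fst q'"
      by (intro exI[of _ "(\<nu>, w)"]) auto
  qed
  then obtain r u where r: "\<And>k. r k < r (Suc k)"
    and u: "\<And>k. u k \<in> Z" "\<And>k. dist (u k) z < inverse (real (Suc k))" "\<And>k. fs (r k) (u k) \<le> a"
    by (metis comp_apply)
  have mono: "strict_mono r" using r by (simp add: strict_mono_Suc_iff)
  have "(\<lambda>k. dist (u k) z) \<longlonglongrightarrow> 0"
    by (rule tendsto_sandwich[OF _ _ tendsto_const LIMSEQ_inverse_real_of_nat])
       (use less_imp_le[OF u(2)] in auto)
  then have lim: "u \<longlonglongrightarrow> z" by (rule tendsto_dist_iff[THEN iffD2])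
  define w where "w \<nu> = (if \<nu> \<in> range r then u (inv r \<nu>) else z)" for \<nu>
  have "w \<longlonglongrightarrow> z" unfolding w_def by (rule tendsto_spread[OF mono lim])
  moreover have "w \<nu> \<in> Z" for \<nu> using u(1) z by (simp add: w_def)
  ultimately have "f z \<le> liminf (\<lambda>\<nu>. fs \<nu> (w \<nu>))"
    using epi z unfolding epi_conv_def by blast
  then have "\<forall>\<^sub>F \<nu> in sequentially. a < fs \<nu> (w \<nu>)"
    using a unfolding le_Liminf_iff by blast
  then obtain N where "\<And>\<nu>. \<nu> \<ge> N \<Longrightarrow> a < fs \<nu> (w \<nu>)"
    unfolding eventually_sequentially by blast
  from this[of "r N"] have "a < fs (r N) (w (r N))"
    using seq_suble[OF mono] by blast
  moreover have "w (r N) = u N" using strict_mono_imp_inj_on[OF mono] by (simp add: w_def)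
  ultimately show False using u(3)[of N] by simp
qed

lemma epi_conv_iff_lower_limit:
  fixes Z :: "'a::metric_space set"
  shows "epi_conv Z fs f \<longleftrightarrow> lower_limit Z fs f \<and>
    (\<forall>z\<in>Z. \<exists>w. (\<forall>\<nu>. w \<nu> \<in> Z) \<and> w \<longlonglongrightarrow> z \<and> limsup (\<lambda>\<nu>. fs \<nu> (w \<nu>)) \<le> f z)"
proof
  assume "epi_conv Z fs f"
  then show "lower_limit Z fs f \<and>
    (\<forall>z\<in>Z. \<exists>w. (\<forall>\<nu>. w \<nu> \<in> Z) \<and> w \<longlonglongrightarrow> z \<and> limsup (\<lambda>\<nu>. fs \<nu> (w \<nu>)) \<le> f z)"
    using epi_conv_imp_lower_limit unfolding epi_conv_def by blast
next
  assume "lower_limit Z fs f \<and>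
    (\<forall>z\<in>Z. \<exists>w. (\<forall>\<nu>. w \<nu> \<in> Z) \<and> w \<longlonglongrightarrow> z \<and> limsup (\<lambda>\<nu>. fs \<nu> (w \<nu>)) \<le> f z)"
  then show "epi_conv Z fs f"
    unfolding epi_conv_def by (blast intro: lower_limit_liminf)
qed

lemma epi_conv_subseq:
  fixes Z :: "'a::metric_space set"
  assumes "epi_conv Z fs f" "strict_mono r"
  shows "epi_conv Z (\<lambda>k. fs (r k)) f"
  unfolding epi_conv_iff_lower_limit
proof (intro conjI ballI)
  show "lower_limit Z (\<lambda>k. fs (r k)) f"
    by (rule lower_limit_subseq[OF epi_conv_imp_lower_limit[OF assms(1)] assms(2)])
  fix z assume "z \<in> Z"
  with assms(1) obtain w where w: "\<And>\<nu>. w \<nu> \<in> Z" "w \<longlonglongrightarrow> z" "limsup (\<lambda>\<nu>. fs \<nu> (w \<nu>)) \<le> f z"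
    unfolding epi_conv_def by blast
  have "limsup (\<lambda>k. fs (r k) (w (r k))) \<le> limsup (\<lambda>\<nu>. fs \<nu> (w \<nu>))"
    using limsup_subseq_mono[OF assms(2), of "\<lambda>\<nu>. fs \<nu> (w \<nu>)"] by (simp add: comp_def)
  moreover have "(\<lambda>k. w (r k)) \<longlonglongrightarrow> z"
    using LIMSEQ_subseq_LIMSEQ[OF w(2) assms(2)] by (simp add: comp_def)
  ultimately show "\<exists>w. (\<forall>k. w k \<in> Z) \<and> w \<longlonglongrightarrow> z \<and> limsup (\<lambda>k. fs (r k) (w k)) \<le> f z"
    using w by (intro exI[of _ "\<lambda>k. w (r k)"]) auto
qed

lemma epi_conv_unique:
  fixes Z :: "'a::metric_space set"
  assumes f: "epi_conv Z fs f" and g: "epi_conv Z fs g" and z: "z \<in> Z"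
  shows "f z = g z"
proof -
  have "f z \<le> g z" if "epi_conv Z fs f" "epi_conv Z fs g" for f g
  proof -
    from that(2) z obtain w where w: "\<And>\<nu>. w \<nu> \<in> Z" "w \<longlonglongrightarrow> z" "limsup (\<lambda>\<nu>. fs \<nu> (w \<nu>)) \<le> g z"
      unfolding epi_conv_def by blast
    have "f z \<le> liminf (\<lambda>\<nu>. fs \<nu> (w \<nu>))"
      using that(1) z w unfolding epi_conv_def by blast
    also have "\<dots> \<le> limsup (\<lambda>\<nu>. fs \<nu> (w \<nu>))" by (simp add: Liminf_le_Limsup)
    finally show ?thesis using w(3) by simp
  qed
  from this[OF f g] this[OF g f] show ?thesis by simp
qed

text \<open>Lower semicontinuity is the case of a constant sequence, so the lemmas on lower limits apply to it.\<close>

lemma lsc_on_iff: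
  fixes Z :: "'a::metric_space set"
  shows "lsc_on Z f \<longleftrightarrow> lower_limit Z (\<lambda>_. f) f"
proof -
  have "f z \<le> Liminf (at z within Z) f \<longleftrightarrow>
      (\<forall>a<f z. \<exists>N::nat. \<exists>\<delta>>0. \<forall>\<nu>\<ge>N. \<forall>w\<in>Z. dist w z < \<delta> \<longrightarrow> a < f w)" if "z \<in> Z" for z
    unfolding le_Liminf_iff eventually_at by (metis dual_order.refl dist_eq_0_iff zero_less_dist_iff)
  then show ?thesis unfolding lsc_on_def lower_limit_def by simp
qed

text \<open>Lower semicontinuity of \<open>f\<close> gives the lower bound along the inserted copies of \<open>f\<close>, and the constant
  sequence at \<open>z\<close> is a recovery sequence for them.\<close>

lemma epi_conv_interleave:
  fixes Z :: "'a::metric_space set"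
  assumes r: "strict_mono (r :: nat \<Rightarrow> nat)" and epi: "epi_conv Z (\<lambda>k. fs (r k)) f" and lsc: "lsc_on Z f"
  shows "epi_conv Z (\<lambda>\<nu>. if \<nu> \<in> range r then fs \<nu> else f) f"
  unfolding epi_conv_iff_lower_limit
proof (intro conjI ballI)
  show "lower_limit Z (\<lambda>\<nu>. if \<nu> \<in> range r then fs \<nu> else f) f"
    unfolding lower_limit_def
  proof (intro ballI allI impI)
    fix z a assume z: "z \<in> Z" and a: "a < f z"
    from lower_limitD[OF epi_conv_imp_lower_limit[OF epi] z a] obtain N1 \<delta>1 where \<delta>1: "\<delta>1 > 0"
      and 1: "\<And>k w. k \<ge> N1 \<Longrightarrow> w \<in> Z \<Longrightarrow> dist w z < \<delta>1 \<Longrightarrow> a < fs (r k) w" by metis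
    from lsc obtain N2 :: nat and \<delta>2 where \<delta>2: "\<delta>2 > 0"
      and 2: "\<And>k w. k \<ge> N2 \<Longrightarrow> w \<in> Z \<Longrightarrow> dist w z < \<delta>2 \<Longrightarrow> a < f w"
      using lower_limitD[of Z "\<lambda>_. f" f z a] z a unfolding lsc_on_iff by metis
    have "a < (if \<nu> \<in> range r then fs \<nu> else f) w"
      if "\<nu> \<ge> r N1" "w \<in> Z" "dist w z < min \<delta>1 \<delta>2" for \<nu> w
      using that 1 2[of N2] by (auto simp: strict_mono_less_eq[OF r])
    then show "\<exists>N. \<exists>\<delta>>0. \<forall>\<nu>\<ge>N. \<forall>w\<in>Z. dist w z < \<delta> \<longrightarrow> a < (if \<nu> \<in> range r then fs \<nu> else f) w"
      using \<delta>1 \<delta>2 by (intro exI[of _ "r N1"] exI[of _ "min \<delta>1 \<delta>2"]) auto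
  qed
next
  fix z assume z: "z \<in> Z"
  with epi obtain u where u: "\<And>k. u k \<in> Z" "u \<longlonglongrightarrow> z" "limsup (\<lambda>k. fs (r k) (u k)) \<le> f z"
    unfolding epi_conv_def by blast
  define w where "w \<nu> = (if \<nu> \<in> range r then u (inv r \<nu>) else z)" for \<nu>
  have "\<forall>\<^sub>F \<nu> in sequentially. (if \<nu> \<in> range r then fs \<nu> else f) (w \<nu>) < a" if a: "f z < a" for a
  proof -
    from u(3) a have "\<forall>\<^sub>F k in sequentially. fs (r k) (u k) < a"
      unfolding Limsup_le_iff by blast
    then obtain N where N: "\<And>k. k \<ge> N \<Longrightarrow> fs (r k) (u k) < a"
      unfolding eventually_sequentially by blast
    have "(if \<nu> \<in> range r then fs \<nu> else f) (w \<nu>) < a" if "\<nu> \<ge> r N" for \<nu>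
      using that N a strict_mono_imp_inj_on[OF r] by (auto simp: w_def strict_mono_less_eq[OF r])
    then show ?thesis unfolding eventually_sequentially by blast
  qed
  then have "limsup (\<lambda>\<nu>. (if \<nu> \<in> range r then fs \<nu> else f) (w \<nu>)) \<le> f z"
    unfolding Limsup_le_iff by blast
  moreover have "w \<longlonglongrightarrow> z" unfolding w_def by (rule tendsto_spread[OF r u(2)])
  moreover have "w \<nu> \<in> Z" for \<nu> using u(1) z by (simp add: w_def)
  ultimately show "\<exists>w. (\<forall>\<nu>. w \<nu> \<in> Z) \<and> w \<longlonglongrightarrow> z \<and>
      limsup (\<lambda>\<nu>. (if \<nu> \<in> range r then fs \<nu> else f) (w \<nu>)) \<le> f z" by blast
qed

text \<open>The lower bound is that of epi-convergence along the constant sequence. For the upper bound,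
  equi-lower semicontinuity forbids \<open>fs \<nu> z\<close> to be much larger than the values along a recovery
  sequence for \<open>z\<close>.\<close>

lemma equi_lsc_epi_conv_imp_pointwise:
  assumes equi: "equi_lsc Z fs" and epi: "epi_conv Z fs f" and z: "z \<in> Z"
  shows "(\<lambda>\<nu>. fs \<nu> z) \<longlonglongrightarrow> f z"
proof (rule order_tendstoI)
  fix a assume "a < f z"
  from lower_limitD[OF epi_conv_imp_lower_limit[OF epi] z this] z
  show "\<forall>\<^sub>F \<nu> in sequentially. a < fs \<nu> z"
    unfolding eventually_sequentially by (metis dist_self)
next
  fix a assume a: "f z < a"
  show "\<forall>\<^sub>F \<nu> in sequentially. fs \<nu> z < a"
  proof (cases "(\<lambda>\<nu>. fs \<nu> z) \<longlonglongrightarrow> - \<infinity>")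
    case True
    then show ?thesis by (rule order_tendstoD) (use a in auto)
  next
    case False
    from a obtain c1 where c1: "f z < ereal c1" "ereal c1 < a" using ereal_dense2 by blast
    from c1(2) obtain c2 where c2: "ereal c1 < ereal c2" "ereal c2 < a" using ereal_dense2 by blast
    from equi z False have equi': "\<forall>\<rho>>0. \<forall>\<epsilon>>0. \<exists>\<nu>b. \<exists>\<delta>>0. \<forall>\<nu>\<ge>\<nu>b.
        min (fs \<nu> z - ereal \<epsilon>) (ereal \<rho>) \<le> (INF w\<in>{w\<in>Z. dist w z \<le> \<delta>}. fs \<nu> w)"
      unfolding equi_lsc_def by auto
    obtain N \<delta> where \<delta>: "\<delta> > 0" and N: "\<And>\<nu>. \<nu> \<ge> N \<Longrightarrow>
        min (fs \<nu> z - ereal (c2 - c1)) (ereal (max 1 c2)) \<le> (INF w\<in>{w\<in>Z. dist w z \<le> \<delta>}. fs \<nu> w)"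
      using equi'[rule_format, of "max 1 c2" "c2 - c1"] c2(1)
      by (auto simp: less_max_iff_disj)
    from epi z obtain w where w: "\<And>\<nu>. w \<nu> \<in> Z" "w \<longlonglongrightarrow> z" "limsup (\<lambda>\<nu>. fs \<nu> (w \<nu>)) \<le> f z"
      unfolding epi_conv_def by blast
    have "\<forall>\<^sub>F \<nu> in sequentially. fs \<nu> (w \<nu>) < ereal c1"
      using w(3) c1(1) unfolding Limsup_le_iff by blast
    moreover have "\<forall>\<^sub>F \<nu> in sequentially. dist (w \<nu>) z < \<delta>"
      using w(2) \<delta> by (rule tendstoD)
    ultimately show ?thesis using eventually_ge_at_top[of N]
    proof eventually_elim
      case (elim \<nu>)
      have "min (fs \<nu> z - ereal (c2 - c1)) (ereal (max 1 c2)) \<le> (INF w\<in>{w\<in>Z. dist w z \<le> \<delta>}. fs \<nu> w)"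
        using N elim by blast
      also have "\<dots> \<le> fs \<nu> (w \<nu>)" by (rule INF_lower) (use w(1) elim in auto)
      also have "\<dots> < ereal c1" by (rule elim)
      finally have "fs \<nu> z - ereal (c2 - c1) < ereal c1"
        using c2(1) by (auto simp: min_less_iff_disj)
      then have "fs \<nu> z < ereal c2" by (cases "fs \<nu> z") auto
      then show ?case using c2(2) by simp
    qed
  qed
qed

section \<open>Minimization over a compact set\<close>

text \<open>Finitely many of the neighbourhoods supplied by the lower limit cover \<open>C\<close>.\<close>

lemma lower_limit_less_INF:
  assumes C: "compact C" and lower: "lower_limit C Fs F" and a: "\<And>y. y \<in> C \<Longrightarrow> a < F y"
  shows "\<exists>N. \<forall>\<nu>\<ge>N. \<forall>y\<in>C. a < Fs \<nu> y"
proof -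
  have "\<forall>y\<in>C. \<exists>N \<delta>. \<delta> > 0 \<and> (\<forall>\<nu>\<ge>N. \<forall>w\<in>C. dist w y < \<delta> \<longrightarrow> a < Fs \<nu> w)"
    using lower a unfolding lower_limit_def by blast
  then obtain N \<delta> where \<delta>: "\<And>y. y \<in> C \<Longrightarrow> \<delta> y > 0"
    and N: "\<And>y \<nu> w. y \<in> C \<Longrightarrow> \<nu> \<ge> N y \<Longrightarrow> w \<in> C \<Longrightarrow> dist w y < \<delta> y \<Longrightarrow> a < Fs \<nu> w"
    by metis
  have cov: "C \<subseteq> (\<Union>y\<in>C. ball y (\<delta> y))" using \<delta> by force
  obtain D where D: "D \<subseteq> C" "finite D" "C \<subseteq> (\<Union>y\<in>D. ball y (\<delta> y))"
    by (rule compactE_image[OF C _ cov]) auto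
  have "a < Fs \<nu> w" if \<nu>: "\<nu> \<ge> (\<Sum>y\<in>D. N y)" and w: "w \<in> C" for \<nu> w
  proof -
    from D(3) w obtain y where y: "y \<in> D" "dist w y < \<delta> y" by (auto simp: dist_commute)
    have "N y \<le> (\<Sum>y\<in>D. N y)" using y(1) D(2) by (simp add: member_le_sum)
    then show ?thesis using N[of y \<nu> w] y D(1) \<nu> w by auto
  qed
  then show ?thesis by blast
qed

lemma tendsto_INF_compact:
  assumes C: "compact C" and lower: "lower_limit C Fs F"
    and pt: "\<And>y. y \<in> C \<Longrightarrow> (\<lambda>\<nu>. Fs \<nu> y) \<longlonglongrightarrow> F y"
  shows "(\<lambda>\<nu>. INF y\<in>C. Fs \<nu> y) \<longlonglongrightarrow> (INF y\<in>C. F y)"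
proof (rule order_tendstoI)
  fix a assume "a < (INF y\<in>C. F y)"
  then obtain b where b: "a < b" "b < (INF y\<in>C. F y)" using dense by blast
  obtain N where N: "\<And>\<nu> y. \<nu> \<ge> N \<Longrightarrow> y \<in> C \<Longrightarrow> b < Fs \<nu> y"
    using lower_limit_less_INF[OF C lower, of b] less_INF_D[OF b(2)] by blast
  have "a < (INF y\<in>C. Fs \<nu> y)" if "\<nu> \<ge> N" for \<nu>
    by (rule less_le_trans[OF b(1)], rule INF_greatest) (use N that less_imp_le in blast)
  then show "\<forall>\<^sub>F \<nu> in sequentially. a < (INF y\<in>C. Fs \<nu> y)"
    unfolding eventually_sequentially by blast
next
  fix a assume "(INF y\<in>C. F y) < a"
  then obtain y where y: "y \<in> C" "F y < a" unfolding INF_less_iff by blast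
  from order_tendstoD(2)[OF pt[OF y(1)] y(2)]
  show "\<forall>\<^sub>F \<nu> in sequentially. (INF y\<in>C. Fs \<nu> y) < a"
    by eventually_elim (use y(1) in \<open>auto simp: INF_less_iff\<close>)
qed

lemma argmin_on_iff: "y \<in> argmin_on C F \<longleftrightarrow> y \<in> C \<and> (\<forall>x\<in>C. F y \<le> F x)"
  by (auto simp: argmin_on_def is_arg_min_def not_less)

text \<open>The limit \<open>F\<close> inherits lower semicontinuity from the sequence, so this is the Weierstrass theorem. If
  every \<open>y\<close> in \<open>C\<close> had a strictly better point \<open>b y\<close>, then by compactness finitely many of the
  values \<open>F (b y)\<close> would bound \<open>F\<close> from below, and the point \<open>b y\<close> with the smallest of them could not
  be improved.\<close>

lemma argmin_on_nonempty:
  assumes C: "compact C" "C \<noteq> {}" and lower: "lower_limit C Fs F"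
    and pt: "\<And>y. y \<in> C \<Longrightarrow> (\<lambda>\<nu>. Fs \<nu> y) \<longlonglongrightarrow> F y"
  shows "argmin_on C F \<noteq> {}"
proof
  assume "argmin_on C F = {}"
  then have "\<forall>y\<in>C. \<exists>x\<in>C. F x < F y" by (auto simp: argmin_on_iff set_eq_iff not_le)
  then obtain b where b: "\<And>y. y \<in> C \<Longrightarrow> b y \<in> C \<and> F (b y) < F y" by metis
  have "\<forall>y\<in>C. \<exists>N \<delta>. \<delta> > 0 \<and> (\<forall>\<nu>\<ge>N. \<forall>w\<in>C. dist w y < \<delta> \<longrightarrow> F (b y) < Fs \<nu> w)"
    using lower b unfolding lower_limit_def by blast
  then obtain N \<delta> where \<delta>: "\<And>y. y \<in> C \<Longrightarrow> \<delta> y > 0"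
    and N: "\<And>y \<nu> w. y \<in> C \<Longrightarrow> \<nu> \<ge> N y \<Longrightarrow> w \<in> C \<Longrightarrow> dist w y < \<delta> y \<Longrightarrow> F (b y) < Fs \<nu> w"
    by metis
  have cov: "C \<subseteq> (\<Union>y\<in>C. ball y (\<delta> y))" using \<delta> by force
  obtain D where D: "D \<subseteq> C" "finite D" "C \<subseteq> (\<Union>y\<in>D. ball y (\<delta> y))"
    by (rule compactE_image[OF C(1) _ cov]) auto
  have "D \<noteq> {}" using D(3) C(2) by auto
  define y0 where "y0 = arg_min_on (\<lambda>y. F (b y)) D"
  have y0: "y0 \<in> D" "F (b y0) \<le> F (b y)" if "y \<in> D" for y
    using arg_min_if_finite(1)[OF D(2) \<open>D \<noteq> {}\<close>, of "\<lambda>y. F (b y)"]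
      arg_min_least[OF D(2) \<open>D \<noteq> {}\<close> that, of "\<lambda>y. F (b y)"] by (simp_all add: y0_def)
  define x where "x = b y0"
  have x: "x \<in> C" using y0(1) D(1) b \<open>D \<noteq> {}\<close> by (auto simp: x_def)
  have "F x < F x"
  proof -
    from D(3) b[OF x] obtain y where y: "y \<in> D" "dist (b x) y < \<delta> y" by (auto simp: dist_commute)
    have yC: "y \<in> C" using y(1) D(1) by blast
    have "F (b y) \<le> F (b x)"
    proof (rule tendsto_lowerbound[OF pt])
      show "b x \<in> C" using b x by blast
      show "\<forall>\<^sub>F \<nu> in sequentially. F (b y) \<le> Fs \<nu> (b x)"
        using eventually_ge_at_top[of "N y"]
        by eventually_elim (use N[OF yC] y b x less_imp_le in blast)
    qed simp
    moreover have "F x \<le> F (b y)" using y0(2) y(1) by (simp add: x_def)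
    ultimately show ?thesis using conjunct2[OF b[OF x]] by order
  qed
  then show False by simp
qed

text \<open>A limit of minimizers has at most the limiting value of any competitor.\<close>

lemma LimOut_argmin_subset:
  assumes C: "compact C" and lower: "lower_limit C Fs F"
    and pt: "\<And>y. y \<in> C \<Longrightarrow> (\<lambda>\<nu>. Fs \<nu> y) \<longlonglongrightarrow> F y"
  shows "LimOut (\<lambda>\<nu>. argmin_on C (Fs \<nu>)) \<subseteq> argmin_on C F"
proof
  fix z assume "z \<in> LimOut (\<lambda>\<nu>. argmin_on C (Fs \<nu>))"
  then obtain r w where r: "strict_mono (r :: nat \<Rightarrow> nat)" and w: "\<And>k. w k \<in> argmin_on C (Fs (r k))"
    and lim: "w \<longlonglongrightarrow> z" unfolding LimOut_def by blast
  have wC: "w k \<in> C" for k using w by (simp add: argmin_on_iff)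
  have z: "z \<in> C" using closed_sequentially[OF compact_imp_closed[OF C] _ lim] wC by blast
  have "F z \<le> F y" if y: "y \<in> C" for y
  proof -
    have "F z \<le> liminf (\<lambda>k. Fs (r k) (w k))"
      using lower_limit_liminf[OF lower_limit_subseq[OF lower r] z wC lim] .
    also have "\<dots> \<le> liminf (\<lambda>k. Fs (r k) y)"
      by (rule Liminf_mono) (use w y in \<open>auto simp: argmin_on_iff\<close>)
    also have "\<dots> = F y"
      using LIMSEQ_subseq_LIMSEQ[OF pt[OF y] r]
      by (intro lim_imp_Liminf) (auto simp: comp_def)
    finally show ?thesis .
  qed
  with z show "z \<in> argmin_on C F" by (simp add: argmin_on_iff)
qed

section \<open>The Attouch--Wets metric\<close>

lemma lsc_fcnsD:
  assumes "f \<in> lsc_fcns X"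
  shows "f \<in> extensional X" "lsc_on X f" "\<exists>x\<in>X. f x \<noteq> \<infinity>"
  using assms unfolding lsc_fcns_def fcns_def by auto

lemma epi_nonempty:
  assumes "f \<in> lsc_fcns X"
  shows "epi X f \<noteq> {}"
proof -
  obtain x where "x \<in> X" "f x \<noteq> \<infinity>" using lsc_fcnsD(3)[OF assms] by blast
  then have "(x, real_of_ereal (f x)) \<in> epi X f"
    unfolding epi_def by (cases "f x") auto
  then show ?thesis by blast
qed

text \<open>Closedness is what lets the distance function of the epigraph determine the epigraph.\<close>

lemma closed_epi:
  fixes X :: "'a::metric_space set"
  assumes X: "closed X" and lsc: "lsc_on X f"
  shows "closed (epi X f)"
  unfolding closed_sequential_limits
proof (intro allI impI, elim conjE)
  fix p l assume p: "\<forall>n. p n \<in> epi X f" and lim: "p \<longlonglongrightarrow> l"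
  obtain x t where l: "l = (x, t)" by force
  have x: "(\<lambda>n. fst (p n)) \<longlonglongrightarrow> x" and t: "(\<lambda>n. snd (p n)) \<longlonglongrightarrow> t"
    using tendsto_fst[OF lim] tendsto_snd[OF lim] l by auto
  have pX: "fst (p n) \<in> X" "f (fst (p n)) \<le> ereal (snd (p n))" for n
    using p[rule_format, of n] by (auto simp: epi_def split_beta)
  have "x \<in> X" using closed_sequentially[OF X _ x] pX by blast
  have "f x \<le> liminf (\<lambda>n. f (fst (p n)))"
    using lower_limit_liminf[OF lsc[unfolded lsc_on_iff] \<open>x \<in> X\<close> pX(1) x] .
  also have "\<dots> \<le> liminf (\<lambda>n. ereal (snd (p n)))"
    by (rule Liminf_mono) (use pX(2) in auto)
  also have "\<dots> = ereal t" using t by (intro lim_imp_Liminf) auto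
  finally show "l \<in> epi X f" using \<open>x \<in> X\<close> l by (simp add: epi_def)
qed

lemma epi_eq_imp_eq:
  assumes f: "f \<in> extensional X" and g: "g \<in> extensional X" and eq: "epi X f = epi X g"
  shows "f = g"
proof (rule extensionalityI[OF f g])
  fix x assume x: "x \<in> X"
  have iff: "f x \<le> ereal t \<longleftrightarrow> g x \<le> ereal t" for t
    using eq x by (auto simp: epi_def set_eq_iff)
  show "f x = g x"
  proof (rule antisym)
    show "f x \<le> g x"
    proof (rule ccontr)
      assume "\<not> f x \<le> g x"
      then obtain t where "g x < ereal t" "ereal t < f x" using ereal_dense2 not_le by metis
      then show False using iff[of t] leD less_imp_le by metis
    qed
    show "g x \<le> f x"
    proof (rule ccontr)
      assume "\<not> g x \<le> f x"
      then obtain t where "f x < ereal t" "ereal t < g x" using ereal_dense2 not_le by metis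
      then show False using iff[of t] leD less_imp_le by metis
    qed
  qed
qed

text \<open>Each property \<open>P n\<close> holds from some index on; \<open>m k\<close> is the largest \<open>n\<close> up to \<open>k\<close> whose threshold has
  been passed at \<open>k\<close>.\<close>

lemma diagonal_index:
  fixes P :: "nat \<Rightarrow> nat \<Rightarrow> bool"
  assumes "\<And>n. eventually (P n) sequentially"
  shows "\<exists>m. filterlim m at_top sequentially \<and> (\<forall>\<^sub>F k in sequentially. P (m k) k)"
proof -
  from assms obtain N where N: "\<And>n k. k \<ge> N n \<Longrightarrow> P n k"
    unfolding eventually_sequentially by metis
  \<comment> \<open>Inserting 0 keeps the maximum defined before any threshold has been passed.\<close>
  define m where "m k = Max (insert 0 {n\<in>{..k}. N n \<le> k})" for k
  have fin: "finite (insert 0 {n\<in>{..k}. N n \<le> k})" for k by simp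
  have "P (m k) k" if "k \<ge> N 0" for k
    using Max_in[OF fin, of k] that N by (auto simp: m_def)
  moreover have "m k \<ge> M" if "k \<ge> max M (N M)" for k M
    unfolding m_def by (rule Max_ge[OF fin]) (use that in auto)
  then have "filterlim m at_top sequentially"
    unfolding filterlim_at_top eventually_sequentially by meson
  ultimately show ?thesis unfolding eventually_sequentially by blast
qed

text \<open>The locale collects what makes the Attouch--Wets distance a metric: the balls around \<open>zctr\<close> within
  \<open>X \<times> UNIV\<close> are then nonempty, and epigraphs of lsc
  functions are closed.\<close>

locale aw_metric =
  fixes X :: "'a::euclidean_space set" and zctr :: "'a \<times> real"
  assumes closed_X: "closed X" and zctr: "zctr \<in> X \<times> UNIV"
begin

definition gap :: "('a \<Rightarrow> ereal) \<Rightarrow> ('a \<Rightarrow> ereal) \<Rightarrow> real \<Rightarrow> real" where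
  "gap f g \<rho> = (SUP z\<in>{z \<in> X \<times> UNIV. dist z zctr \<le> \<rho>}. \<bar>infdist z (epi X f) - infdist z (epi X g)\<bar>)"

lemma aw_dist_eq: "aw_dist X zctr f g = (LBINT \<rho>:{0..}. gap f g \<rho> * exp (- \<rho>))"
  by (simp add: aw_dist_def gap_def)

text \<open>Linear growth in \<open>\<rho>\<close> makes the suprema finite and the integral against \<open>exp (- \<rho>)\<close> convergent.\<close>

lemma infdist_diff_bound:
  fixes A B :: "('a \<times> real) set"
  assumes "dist z zctr \<le> \<rho>"
  shows "\<bar>infdist z A - infdist z B\<bar> \<le> infdist zctr A + infdist zctr B + 2 * \<rho>"
  using infdist_triangle[of z A zctr] infdist_triangle[of z B zctr] infdist_nonneg[of z A]
    infdist_nonneg[of z B] infdist_nonneg[of zctr A] infdist_nonneg[of zctr B] assms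
    zero_le_dist[of z zctr] by linarith

lemma gap_bdd:
  "bdd_above ((\<lambda>z. \<bar>infdist z (epi X f) - infdist z (epi X g)\<bar>) ` {z \<in> X \<times> UNIV. dist z zctr \<le> \<rho>})"
  by (rule bdd_aboveI2) (use infdist_diff_bound in blast)

lemma gap_upper:
  assumes "z \<in> X \<times> UNIV" "dist z zctr \<le> \<rho>"
  shows "\<bar>infdist z (epi X f) - infdist z (epi X g)\<bar> \<le> gap f g \<rho>"
  unfolding gap_def by (rule cSUP_upper[OF _ gap_bdd]) (use assms in auto)

lemma gap_least:
  assumes "\<rho> \<ge> 0"
    and "\<And>z. z \<in> X \<times> UNIV \<Longrightarrow> dist z zctr \<le> \<rho> \<Longrightarrow> \<bar>infdist z (epi X f) - infdist z (epi X g)\<bar> \<le> c"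
  shows "gap f g \<rho> \<le> c"
  unfolding gap_def
proof (rule cSUP_least)
  have "zctr \<in> {z \<in> X \<times> UNIV. dist z zctr \<le> \<rho>}" using assms(1) zctr by simp
  then show "{z \<in> X \<times> UNIV. dist z zctr \<le> \<rho>} \<noteq> {}" by blast
qed (use assms(2) in auto)

lemma gap_nonneg: "\<rho> \<ge> 0 \<Longrightarrow> 0 \<le> gap f g \<rho>"
  using gap_upper[of zctr \<rho> f g] zctr by (auto intro: order_trans[OF abs_ge_zero])

lemma gap_mono: "0 \<le> \<rho> \<Longrightarrow> \<rho> \<le> \<sigma> \<Longrightarrow> gap f g \<rho> \<le> gap f g \<sigma>"
  by (rule gap_least) (auto intro: gap_upper)

lemma gap_triangle: "\<rho> \<ge> 0 \<Longrightarrow> gap f h \<rho> \<le> gap f g \<rho> + gap g h \<rho>"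
proof (rule gap_least)
  fix z assume z: "z \<in> X \<times> UNIV" "dist z zctr \<le> \<rho>"
  show "\<bar>infdist z (epi X f) - infdist z (epi X h)\<bar> \<le> gap f g \<rho> + gap g h \<rho>"
    using gap_upper[OF z, of f g] gap_upper[OF z, of g h] by linarith
qed

text \<open>The gap is monotone in \<open>\<rho>\<close>, hence measurable, and grows at most linearly.\<close>

lemma gap_set_integrable: "set_integrable lborel {0..} (\<lambda>\<rho>. gap f g \<rho> * exp (- \<rho>))"
proof -
  define c where "c = infdist zctr (epi X f) + infdist zctr (epi X g)"
  have meas: "(\<lambda>\<rho>. indicator {0..} \<rho> *\<^sub>R (gap f g \<rho> * exp (- \<rho>))) \<in> borel_measurable lborel"
  proof -
    have "mono (\<lambda>\<rho>. if \<rho> < 0 then 0 else gap f g \<rho>)"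
      by (rule monoI) (auto intro: gap_mono gap_nonneg)
    then have "(\<lambda>\<rho>. if \<rho> < 0 then 0 else gap f g \<rho>) \<in> borel_measurable borel"
      by (rule borel_measurable_mono)
    then have "(\<lambda>\<rho>. indicator {0..} \<rho> * ((if \<rho> < 0 then 0 else gap f g \<rho>) * exp (- \<rho>))) \<in> borel_measurable borel"
      by (intro borel_measurable_times) auto
    moreover have "(\<lambda>\<rho>. indicator {0..} \<rho> * ((if \<rho> < 0 then 0 else gap f g \<rho>) * exp (- \<rho>))) =
        (\<lambda>\<rho>. indicator {0..} \<rho> *\<^sub>R (gap f g \<rho> * exp (- \<rho>)))"
      by (auto simp: fun_eq_iff indicator_def)
    ultimately show ?thesis by simp
  qed
  have "integrable lborel (\<lambda>x. c * (x^0 * exp (-x) * indicator {0 ..} x) +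
      2 * (x^1 * exp (-x) * indicator {0 ..} x) :: real)"
    using has_bochner_integral_I0i_power_exp_m'[THEN integrable.intros]
    by (intro Bochner_Integration.integrable_add integrable_mult_right) blast+
  then have "integrable lborel (\<lambda>\<rho>. indicator {0..} \<rho> *\<^sub>R (gap f g \<rho> * exp (- \<rho>)))"
  proof (rule Bochner_Integration.integrable_bound[OF _ meas], intro AE_I2)
    fix \<rho> :: real
    show "norm (indicator {0..} \<rho> *\<^sub>R (gap f g \<rho> * exp (- \<rho>))) \<le>
      norm (c * (\<rho>^0 * exp (-\<rho>) * indicator {0 ..} \<rho>) + 2 * (\<rho>^1 * exp (-\<rho>) * indicator {0 ..} \<rho>))"
    proof (cases "\<rho> \<ge> 0")
      case True
      have "gap f g \<rho> \<le> c + 2 * \<rho>"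
        unfolding c_def by (rule gap_least[OF True]) (rule infdist_diff_bound)
      then have "gap f g \<rho> * exp (- \<rho>) \<le> (c + 2 * \<rho>) * exp (- \<rho>)"
        by (rule mult_right_mono) simp
      moreover have "0 \<le> gap f g \<rho> * exp (- \<rho>)" using gap_nonneg[OF True] by simp
      ultimately show ?thesis using True by (simp add: algebra_simps)
    qed simp
  qed
  then show ?thesis unfolding set_integrable_def .
qed

lemma aw_dist_nonneg: "0 \<le> aw_dist X zctr f g"
  unfolding aw_dist_eq set_lebesgue_integral_def
  by (rule Bochner_Integration.integral_nonneg) (simp add: gap_nonneg indicator_def)

text \<open>Since the gap is monotone, its integral over the unit interval to the right of \<open>\<rho>\<close> already bounds the
  distance from below. This is how smallness of the distance is turned into smallness at single
  points.\<close>

lemma gap_le_aw_dist: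
  assumes "\<rho> \<ge> 0"
  shows "gap f g \<rho> * exp (- (\<rho> + 1)) \<le> aw_dist X zctr f g"
proof -
  have sub: "set_integrable lborel {\<rho>..\<rho>+1} (\<lambda>\<rho>. gap f g \<rho> * exp (- \<rho>))"
    by (rule set_integrable_subset[OF gap_set_integrable]) (use assms in auto)
  have "gap f g \<rho> * exp (- (\<rho> + 1)) = (LBINT t:{\<rho>..\<rho>+1}. gap f g \<rho> * exp (- (\<rho> + 1)))"
    by (simp add: set_lebesgue_integral_def)
  also have "\<dots> \<le> (LBINT t:{\<rho>..\<rho>+1}. gap f g t * exp (- t))"
  proof (rule set_integral_mono[OF _ sub])
    show "set_integrable lborel {\<rho>..\<rho>+1} (\<lambda>_. gap f g \<rho> * exp (- (\<rho> + 1)))"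
      unfolding set_integrable_def by simp
    fix t assume "t \<in> {\<rho>..\<rho>+1}"
    then show "gap f g \<rho> * exp (- (\<rho> + 1)) \<le> gap f g t * exp (- t)"
      using assms by (intro mult_mono gap_mono gap_nonneg) auto
  qed
  also have "\<dots> \<le> (LBINT t:{0..}. gap f g t * exp (- t))"
    unfolding set_lebesgue_integral_def
  proof (rule integral_mono)
    show "integrable lborel (\<lambda>t. indicator {\<rho>..\<rho>+1} t *\<^sub>R (gap f g t * exp (- t)))"
      using sub unfolding set_integrable_def .
    show "integrable lborel (\<lambda>t. indicator {0..} t *\<^sub>R (gap f g t * exp (- t)))"
      using gap_set_integrable unfolding set_integrable_def .
    fix t :: real
    show "indicator {\<rho>..\<rho>+1} t *\<^sub>R (gap f g t * exp (- t)) \<le> indicator {0..} t *\<^sub>R (gap f g t * exp (- t))"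
      using assms gap_nonneg[of t f g] by (auto simp: indicator_def)
  qed
  finally show ?thesis by (simp add: aw_dist_eq)
qed

lemma aw_dist_self: "aw_dist X zctr f f = 0"
proof -
  have "gap f f \<rho> = 0" if "\<rho> \<ge> 0" for \<rho>
    using gap_least[OF that, of f f 0] gap_nonneg[OF that, of f f] by simp
  then have "(\<lambda>\<rho>. indicator {0..} \<rho> *\<^sub>R (gap f f \<rho> * exp (- \<rho>))) = (\<lambda>\<rho>. 0)"
    by (auto simp: fun_eq_iff indicator_def)
  then show ?thesis unfolding aw_dist_eq set_lebesgue_integral_def by simp
qed

lemma infdist_diff_le_aw_dist:
  assumes "z \<in> X \<times> UNIV"
  shows "\<bar>infdist z (epi X f) - infdist z (epi X g)\<bar> \<le> exp (dist z zctr + 1) * aw_dist X zctr f g"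
proof -
  have "\<bar>infdist z (epi X f) - infdist z (epi X g)\<bar> \<le> gap f g (dist z zctr)"
    by (rule gap_upper[OF assms order_refl])
  also have "\<dots> = exp (dist z zctr + 1) * (gap f g (dist z zctr) * exp (- (dist z zctr + 1)))"
    by (simp only: mult.left_commute[of "exp (dist z zctr + 1)"] exp_minus_inverse mult_1_right)
  also have "\<dots> \<le> exp (dist z zctr + 1) * aw_dist X zctr f g"
    using gap_le_aw_dist by (intro mult_left_mono) auto
  finally show ?thesis .
qed

lemma aw_dist_zero_imp_eq:
  assumes f: "f \<in> lsc_fcns X" and g: "g \<in> lsc_fcns X" and "aw_dist X zctr f g = 0"
  shows "f = g"
proof (rule epi_eq_imp_eq)
  have same: "infdist z (epi X f) = infdist z (epi X g)" if "z \<in> X \<times> UNIV" for z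
    using infdist_diff_le_aw_dist[OF that, of f g] assms(3) by simp
  have mem: "z \<in> epi X h \<longleftrightarrow> infdist z (epi X h) = 0" if "h \<in> lsc_fcns X" for z h
    by (rule in_closed_iff_infdist_zero[OF closed_epi[OF closed_X lsc_fcnsD(2)[OF that]] epi_nonempty[OF that]])
  have dom: "z \<in> X \<times> UNIV" if "z \<in> epi X h" for z h using that by (auto simp: epi_def)
  show "epi X f = epi X g"
  proof (rule set_eqI)
    fix z
    show "z \<in> epi X f \<longleftrightarrow> z \<in> epi X g"
      using same[of z] mem[OF f, of z] mem[OF g, of z] dom[of z] by metis
  qed
qed (use f g lsc_fcnsD(1) in auto)

lemma aw_dist_triangle: "aw_dist X zctr f h \<le> aw_dist X zctr f g + aw_dist X zctr g h"
proof -
  have "aw_dist X zctr f h \<le> (LBINT \<rho>:{0..}. gap f g \<rho> * exp (- \<rho>) + gap g h \<rho> * exp (- \<rho>))"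
    unfolding aw_dist_eq
  proof (rule set_integral_mono[OF gap_set_integrable set_integral_add(1)[OF gap_set_integrable gap_set_integrable]])
    fix \<rho> :: real assume "\<rho> \<in> {0..}"
    then show "gap f h \<rho> * exp (- \<rho>) \<le> gap f g \<rho> * exp (- \<rho>) + gap g h \<rho> * exp (- \<rho>)"
      using mult_right_mono[OF gap_triangle[of \<rho> f h g], of "exp (- \<rho>)"] by (simp add: algebra_simps)
  qed
  also have "\<dots> = aw_dist X zctr f g + aw_dist X zctr g h"
    unfolding aw_dist_eq by (rule set_integral_add(2)[OF gap_set_integrable gap_set_integrable])
  finally show ?thesis .
qed

sublocale Metric_space "lsc_fcns X" "aw_dist X zctr"
proof
  fix f g h
  show "0 \<le> aw_dist X zctr f g" by (rule aw_dist_nonneg)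
  show "aw_dist X zctr f g = aw_dist X zctr g f"
    unfolding aw_dist_def by (simp only: abs_minus_commute)
  assume "f \<in> lsc_fcns X" "g \<in> lsc_fcns X"
  then show "aw_dist X zctr f g = 0 \<longleftrightarrow> f = g"
    using aw_dist_zero_imp_eq aw_dist_self by blast
  show "aw_dist X zctr f h \<le> aw_dist X zctr f g + aw_dist X zctr g h" by (rule aw_dist_triangle)
qed

text \<open>Convergence in the metric gives pointwise convergence of the distances to the epigraphs. A point
  \<open>(z, c)\<close> strictly below the graph of \<open>f\<close> has positive distance to the epigraph, hence eventually
  keeps a positive distance to those of \<open>fs k\<close>: this is the lower limit. A point \<open>(z, t)\<close> of the
  epigraph is eventually close to points of the other epigraphs: this gives a recovery sequence. If
  \<open>f z = - \<infinity>\<close> there is no lowest point above \<open>z\<close>, so heights \<open>t n\<close> tending to \<open>- \<infinity>\<close> are used and the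
  sequence is chosen diagonally.\<close>

lemma aw_convergence_imp_epi_conv:
  assumes fs: "\<And>k. fs k \<in> lsc_fcns X" and f: "f \<in> lsc_fcns X"
    and lim: "(\<lambda>k. aw_dist X zctr (fs k) f) \<longlonglongrightarrow> 0"
  shows "epi_conv X fs f"
  unfolding epi_conv_iff_lower_limit
proof (intro conjI ballI)
  have inf_lim: "(\<lambda>k. infdist z (epi X (fs k))) \<longlonglongrightarrow> infdist z (epi X f)" if "z \<in> X \<times> UNIV" for z
  proof (rule LIM_zero_cancel)
    have "(\<lambda>k. exp (dist z zctr + 1) * aw_dist X zctr (fs k) f) \<longlonglongrightarrow> 0"
      by (rule tendsto_mult_right_zero[OF lim])
    then show "(\<lambda>k. infdist z (epi X (fs k)) - infdist z (epi X f)) \<longlonglongrightarrow> 0"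
      by (rule Lim_null_comparison[OF always_eventually, OF allI, rotated])
         (simp add: infdist_diff_le_aw_dist[OF that])
  qed
  show "lower_limit X fs f"
    unfolding lower_limit_def
  proof (intro ballI allI impI)
    fix z a assume z: "z \<in> X" and "a < f z"
    then obtain c where c: "a < ereal c" "ereal c < f z" using ereal_dense2 by blast
    have "(z, c) \<notin> epi X f" using c(2) by (auto simp: epi_def)
    then have pos: "0 < infdist (z, c) (epi X f)"
      using in_closed_iff_infdist_zero[OF closed_epi[OF closed_X lsc_fcnsD(2)[OF f]] epi_nonempty[OF f]]
        infdist_nonneg[of "(z, c)" "epi X f"] by (metis less_eq_real_def)
    \<comment> \<open>Half of the distance is spent on the convergence of the distances, half on moving from \<open>z\<close> to \<open>w\<close>.\<close>
    define \<delta> where "\<delta> = infdist (z, c) (epi X f) / 2"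
    have "\<forall>\<^sub>F k in sequentially. \<delta> < infdist (z, c) (epi X (fs k))"
      by (rule order_tendstoD(1)[OF inf_lim]) (use z pos in \<open>auto simp: \<delta>_def\<close>)
    then obtain N where N: "\<And>k. k \<ge> N \<Longrightarrow> \<delta> < infdist (z, c) (epi X (fs k))"
      unfolding eventually_sequentially by blast
    have "a < fs k w" if "k \<ge> N" "w \<in> X" "dist w z < \<delta>" for k w
    proof (rule ccontr)
      assume "\<not> a < fs k w"
      then have "fs k w \<le> ereal c" using c(1) by simp
      then have "(w, c) \<in> epi X (fs k)" using that by (simp add: epi_def)
      then have "infdist (z, c) (epi X (fs k)) \<le> dist (z, c) (w, c)" by (rule infdist_le)
      also have "\<dots> = dist w z" by (simp add: dist_Pair_Pair dist_commute)
      finally show False using N[OF that(1)] that(3) by simp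
    qed
    then show "\<exists>N. \<exists>\<delta>>0. \<forall>\<nu>\<ge>N. \<forall>w\<in>X. dist w z < \<delta> \<longrightarrow> a < fs \<nu> w"
      using pos by (intro exI[of _ N] exI[of _ \<delta>]) (auto simp: \<delta>_def)
  qed
  fix z assume z: "z \<in> X"
  show "\<exists>w. (\<forall>\<nu>. w \<nu> \<in> X) \<and> w \<longlonglongrightarrow> z \<and> limsup (\<lambda>\<nu>. fs \<nu> (w \<nu>)) \<le> f z"
  proof (cases "f z = \<infinity>")
    case True
    then show ?thesis using z by (intro exI[of _ "\<lambda>_. z"]) auto
  next
    case False
    define t where "t n = (if f z = - \<infinity> then - real n else real_of_ereal (f z))" for n :: nat
    have t: "f z \<le> ereal (t n)" for n using False by (cases "f z") (auto simp: t_def)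
    define Q where "Q n k w \<longleftrightarrow> w \<in> X \<and> dist w z < inverse (real (Suc n)) \<and>
        fs k w < ereal (t n + inverse (real (Suc n)))" for n k w
    have near: "\<forall>\<^sub>F k in sequentially. \<exists>w. Q n k w" for n
    proof -
      have "(z, t n) \<in> epi X f" using z t by (simp add: epi_def)
      then have "infdist (z, t n) (epi X f) = 0" by simp
      then have "\<forall>\<^sub>F k in sequentially. infdist (z, t n) (epi X (fs k)) < inverse (real (Suc n))"
        using z by (intro order_tendstoD(2)[OF inf_lim]) auto
      then show ?thesis
      proof eventually_elim
        case (elim k)
        then obtain p where p: "p \<in> epi X (fs k)" "dist (z, t n) p < inverse (real (Suc n))"
          using infdist_notempty[OF epi_nonempty[OF fs]] cINF_less_iff[OF epi_nonempty[OF fs] bdd_below_image_dist]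
          by metis
        obtain w s where ws: "p = (w, s)" by force
        have "dist z w \<le> dist (z, t n) p" "dist (t n) s \<le> dist (z, t n) p"
          using dist_fst_le[of "(z, t n)" p] dist_snd_le[of "(z, t n)" p] ws by auto
        then have "dist w z < inverse (real (Suc n))" "s < t n + inverse (real (Suc n))"
          using p(2) by (auto simp: dist_commute dist_real_def)
        then show ?case using p(1) ws
          by (intro exI[of _ w]) (auto simp: epi_def Q_def intro: le_less_trans)
      qed
    qed
    obtain m where m: "filterlim m at_top sequentially"
      and ev: "\<forall>\<^sub>F k in sequentially. \<exists>w. Q (m k) k w"
      using diagonal_index[of "\<lambda>n k. \<exists>w. Q n k w", OF near] by auto
    define w where "w k = (if \<exists>w. Q (m k) k w then SOME w. Q (m k) k w else z)" for k
    have w: "Q (m k) k (w k)" if "\<exists>w. Q (m k) k w" for k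
      using someI_ex[OF that] that by (simp add: w_def)
    have wX: "w k \<in> X" for k
    proof (cases "\<exists>w. Q (m k) k w")
      case True
      then show ?thesis using w by (simp add: Q_def)
    qed (simp add: w_def z)
    have "(\<lambda>k. dist (w k) z) \<longlonglongrightarrow> 0"
    proof (rule tendsto_sandwich[OF _ _ tendsto_const])
      show "(\<lambda>k. inverse (real (Suc (m k)))) \<longlonglongrightarrow> 0"
        by (rule filterlim_compose[OF LIMSEQ_inverse_real_of_nat m])
      show "\<forall>\<^sub>F k in sequentially. dist (w k) z \<le> inverse (real (Suc (m k)))"
        using ev by eventually_elim (use w in \<open>simp add: Q_def less_imp_le\<close>)
    qed simp
    then have "w \<longlonglongrightarrow> z" by (rule tendsto_dist_iff[THEN iffD2])
    moreover have "limsup (\<lambda>k. fs k (w k)) \<le> f z"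
    proof -
      have "(\<lambda>n. ereal (t n + inverse (real (Suc n)))) \<longlonglongrightarrow> f z"
      proof (cases "f z")
        case (real r)
        then show ?thesis
          using tendsto_add[OF tendsto_const LIMSEQ_inverse_real_of_nat, of r] by (simp add: t_def)
      next
        case MInf
        have "filterlim (\<lambda>n. - real n + inverse (real (Suc n))) at_bot sequentially"
          by real_asymp
        then show ?thesis using MInf by (simp add: t_def tendsto_MInfty filterlim_at_bot_dense)
      qed (use False in simp)
      from filterlim_compose[OF this m]
      have lim_t: "(\<lambda>k. ereal (t (m k) + inverse (real (Suc (m k))))) \<longlonglongrightarrow> f z" .
      have "limsup (\<lambda>k. fs k (w k)) \<le> limsup (\<lambda>k. ereal (t (m k) + inverse (real (Suc (m k)))))"
        by (rule Limsup_mono, use ev in eventually_elim) (use w in \<open>simp add: Q_def less_imp_le\<close>)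
      also have "\<dots> = f z" by (rule lim_imp_Limsup[OF _ lim_t]) simp
      finally show ?thesis .
    qed
    ultimately show ?thesis using wX by blast
  qed
qed

lemma compact_imp_epi_conv_subseq:
  assumes V: "compactin mtopology \<V>" and W: "\<And>k. W k \<in> \<V>"
  obtains r f where "strict_mono (r :: nat \<Rightarrow> nat)" "f \<in> \<V>" "epi_conv X (\<lambda>k. W (r k)) f"
proof -
  have sub: "\<V> \<subseteq> lsc_fcns X" using V compactin_subset_topspace by fastforce
  obtain f r where f: "f \<in> \<V>" and r: "strict_mono (r :: nat \<Rightarrow> nat)"
    and lim: "limitin mtopology (W \<circ> r) f sequentially"
    using V W unfolding compactin_sequentially by (metis image_subsetI)
  have "epi_conv X (\<lambda>k. W (r k)) f"
    by (rule aw_convergence_imp_epi_conv) (use lim f sub W in \<open>auto simp: limitin_metric_dist_null comp_def\<close>)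
  with r f show thesis by (rule that)
qed

end

section \<open>Expectations under weak convergence\<close>

lemma borel_prob_onD:
  assumes "borel_prob_on S M"
  shows "prob_space M" "space M = S"
    "borel_measurable M = borel_measurable (restrict_space borel S)"
proof -
  have sets: "sets M = sets (restrict_space borel S)" and "prob_space M"
    using assms by (auto simp: borel_prob_on_def)
  then show "prob_space M" "space M = S"
    using sets_eq_imp_space_eq[OF sets] by (auto simp: space_restrict_space)
  show "borel_measurable M = borel_measurable (restrict_space borel S)"
    by (rule measurable_cong_sets[OF sets refl])
qed

text \<open>Each point has a neighbourhood on which \<open>gs \<nu>\<close> and \<open>g\<close> both stay close to the value of \<open>g\<close> at that
  point; finitely many of them cover \<open>K\<close>.\<close>

lemma uniform_on_compact:
  fixes g :: "'a::metric_space \<Rightarrow> real"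
  assumes K: "compact K" "K \<subseteq> Z" and e: "e > 0"
    and joint: "\<And>z. z \<in> Z \<Longrightarrow> ((\<lambda>(\<nu>, w). gs \<nu> w) \<longlongrightarrow> g z) (joint_filter z Z)"
    and cont: "continuous_on Z g"
  shows "\<exists>N. \<forall>\<nu>\<ge>N. \<forall>w\<in>K. \<bar>gs \<nu> w - g w\<bar> < e"
proof -
  have "\<exists>N. \<exists>\<delta>>0. \<forall>\<nu>\<ge>N. \<forall>w\<in>Z. dist w z < \<delta> \<longrightarrow> \<bar>gs \<nu> w - g w\<bar> < e" if z: "z \<in> K" for z
  proof -
    have zZ: "z \<in> Z" using z K(2) by blast
    have "\<forall>\<^sub>F p in joint_filter z Z. dist (case p of (\<nu>, w) \<Rightarrow> gs \<nu> w) (g z) < e / 2"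
      by (rule tendstoD[OF joint[OF zZ]]) (use e in simp)
    then obtain N \<delta>1 where 1: "\<delta>1 > 0"
      "\<And>\<nu> w. \<nu> \<ge> N \<Longrightarrow> w \<in> Z \<Longrightarrow> dist w z < \<delta>1 \<Longrightarrow> \<bar>gs \<nu> w - g z\<bar> < e / 2"
      unfolding eventually_joint_filter by (auto simp: dist_real_def)
    obtain \<delta>2 where 2: "\<delta>2 > 0" "\<And>w. w \<in> Z \<Longrightarrow> dist w z < \<delta>2 \<Longrightarrow> \<bar>g w - g z\<bar> < e / 2"
      using cont[unfolded continuous_on_iff, rule_format, OF zZ, of "e / 2"] e
      by (auto simp: dist_real_def)
    have "\<bar>gs \<nu> w - g w\<bar> < e" if "\<nu> \<ge> N" "w \<in> Z" "dist w z < min \<delta>1 \<delta>2" for \<nu> w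
    proof -
      have "\<bar>gs \<nu> w - g z\<bar> < e / 2" "\<bar>g w - g z\<bar> < e / 2"
        using 1(2)[of \<nu> w] 2(2)[of w] that by auto
      then show ?thesis by linarith
    qed
    then show ?thesis using 1(1) 2(1) by (intro exI[of _ N] exI[of _ "min \<delta>1 \<delta>2"]) auto
  qed
  then obtain N \<delta> where \<delta>: "\<And>z. z \<in> K \<Longrightarrow> \<delta> z > 0"
    and N: "\<And>z \<nu> w. z \<in> K \<Longrightarrow> \<nu> \<ge> N z \<Longrightarrow> w \<in> Z \<Longrightarrow> dist w z < \<delta> z \<Longrightarrow> \<bar>gs \<nu> w - g w\<bar> < e"
    by metis
  have cov: "K \<subseteq> (\<Union>y\<in>K. ball y (\<delta> y))" using \<delta> by force
  obtain D where D: "D \<subseteq> K" "finite D" "K \<subseteq> (\<Union>y\<in>D. ball y (\<delta> y))"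
    by (rule compactE_image[OF K(1) _ cov]) auto
  have "\<bar>gs \<nu> w - g w\<bar> < e" if \<nu>: "\<nu> \<ge> (\<Sum>y\<in>D. N y)" and w: "w \<in> K" for \<nu> w
  proof -
    from D(3) w obtain y where y: "y \<in> D" "dist w y < \<delta> y" by (auto simp: dist_commute)
    have "N y \<le> (\<Sum>y\<in>D. N y)" using y(1) D(2) by (simp add: member_le_sum)
    then show ?thesis using N[of y \<nu> w] y D(1) K(2) \<nu> w by auto
  qed
  then show ?thesis by blast
qed

text \<open>The limit of a continuously convergent sequence is continuous although its members need not be: the
  bounds near \<open>z\<close> hold for all late \<open>\<nu>\<close> at once and pass to the limit at each nearby point.\<close>

lemma joint_limit_continuous:
  fixes g :: "'a::metric_space \<Rightarrow> real"
  assumes joint: "\<And>z. z \<in> Z \<Longrightarrow> ((\<lambda>(\<nu>, w). gs \<nu> w) \<longlongrightarrow> g z) (joint_filter z Z)"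
  shows "continuous_on Z g"
    and "z \<in> Z \<Longrightarrow> (\<lambda>\<nu>. gs \<nu> z) \<longlonglongrightarrow> g z"
proof -
  have near: "\<exists>N. \<exists>\<delta>>0. \<forall>\<nu>\<ge>N. \<forall>w\<in>Z. dist w z < \<delta> \<longrightarrow> dist (gs \<nu> w) (g z) < e"
    if "z \<in> Z" "e > 0" for z e
    using tendstoD[OF joint[OF that(1)] that(2)] unfolding eventually_joint_filter by simp
  have pt: "(\<lambda>\<nu>. gs \<nu> z) \<longlonglongrightarrow> g z" if "z \<in> Z" for z
    unfolding LIMSEQ_def using near[OF that] that by (metis dist_self)
  then show "z \<in> Z \<Longrightarrow> (\<lambda>\<nu>. gs \<nu> z) \<longlonglongrightarrow> g z" .
  show "continuous_on Z g"
    unfolding continuous_on_iff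
  proof (intro ballI allI impI)
    fix z and e :: real assume z: "z \<in> Z" and e: "e > 0"
    obtain N \<delta> where \<delta>: "\<delta> > 0"
      and N: "\<And>\<nu> w. \<nu> \<ge> N \<Longrightarrow> w \<in> Z \<Longrightarrow> dist w z < \<delta> \<Longrightarrow> dist (gs \<nu> w) (g z) < e / 2"
      using near[OF z, of "e / 2"] e by auto
    have "dist (g w) (g z) < e" if w: "w \<in> Z" "dist w z < \<delta>" for w
    proof -
      have "(\<lambda>\<nu>. dist (gs \<nu> w) (g z)) \<longlonglongrightarrow> dist (g w) (g z)"
        by (intro tendsto_intros pt w)
      then have "dist (g w) (g z) \<le> e / 2"
        by (rule LIMSEQ_le_const2) (use N[OF _ w] less_imp_le in blast)
      then show ?thesis using e by simp
    qed
    with \<delta> show "\<exists>\<delta>>0. \<forall>w\<in>Z. dist w z < \<delta> \<longrightarrow> dist (g w) (g z) < e" by blast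
  qed
qed

text \<open>A continuous function vanishing on the ball of radius \<open>R\<close> and equal to one outside the ball of radius
  \<open>R + 1\<close>. Its expectation measures the mass far out and passes to weak limits.\<close>

definition cutoff :: "real \<Rightarrow> 'a::real_normed_vector \<Rightarrow> real" where
  "cutoff R x = min 1 (max 0 (norm x - R))"

lemma cutoff_bounds: "0 \<le> cutoff R x" "cutoff R x \<le> 1"
  by (auto simp: cutoff_def)

lemma continuous_on_cutoff: "continuous_on S (cutoff R)"
  unfolding cutoff_def by (intro continuous_intros)

text \<open>Weak convergence treats the fixed continuous integrand \<open>g\<close>. The difference between \<open>gs \<nu>\<close> and \<open>g\<close> is
  uniformly small on a large compact part of \<open>\<Xi>\<close> and at most \<open>2 T\<close> elsewhere, where the measures
  carry little mass by weak convergence applied to \<open>cutoff\<close>.\<close>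

lemma bounded_expectation_limit:
  fixes g :: "'a::euclidean_space \<Rightarrow> real"
  assumes closed: "closed \<Xi>" and P: "borel_prob_on \<Xi> P" and Ps: "\<And>\<nu>. borel_prob_on \<Xi> (Ps \<nu>)"
    and weak: "weak_conv_on \<Xi> Ps P"
    and meas: "\<And>\<nu>. gs \<nu> \<in> borel_measurable (Ps \<nu>)"
    and bd: "\<And>\<nu> z. z \<in> \<Xi> \<Longrightarrow> \<bar>gs \<nu> z\<bar> \<le> T"
    and joint: "\<And>z. z \<in> \<Xi> \<Longrightarrow> ((\<lambda>(\<nu>, w). gs \<nu> w) \<longlongrightarrow> g z) (joint_filter z \<Xi>)"
  shows "(\<lambda>\<nu>. \<integral>z. gs \<nu> z \<partial>Ps \<nu>) \<longlonglongrightarrow> (\<integral>z. g z \<partial>P)"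
proof -
  interpret P: prob_space P by (rule borel_prob_onD(1)[OF P])
  have cont: "continuous_on \<Xi> g" by (rule joint_limit_continuous(1)[OF joint])
  have g_bd: "\<bar>g z\<bar> \<le> T" if "z \<in> \<Xi>" for z
    by (rule LIMSEQ_le_const2[OF tendsto_rabs[OF joint_limit_continuous(2)[OF joint that]]])
       (use bd that in auto)
  have int: "integrable M h"
    if M: "borel_prob_on \<Xi> M" and "h \<in> borel_measurable M" "\<And>z. z \<in> \<Xi> \<Longrightarrow> \<bar>h z\<bar> \<le> c"
    for M and h :: "'a \<Rightarrow> real" and c
  proof -
    interpret prob_space M by (rule borel_prob_onD(1)[OF M])
    show ?thesis
      by (rule integrable_const_bound[of _ c]) (use that borel_prob_onD(2)[OF M] in auto)
  qed
  have meas_cont: "h \<in> borel_measurable M" if "borel_prob_on \<Xi> M" "continuous_on \<Xi> h" for M and h :: "'a \<Rightarrow> real"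
    unfolding borel_prob_onD(3)[OF that(1)] by (rule borel_measurable_continuous_on_restrict[OF that(2)])
  have weakD: "(\<lambda>\<nu>. \<integral>z. h z \<partial>Ps \<nu>) \<longlonglongrightarrow> (\<integral>z. h z \<partial>P)"
    if "continuous_on \<Xi> h" "\<And>z. z \<in> \<Xi> \<Longrightarrow> \<bar>h z\<bar> \<le> c" for h :: "'a \<Rightarrow> real" and c
    using weak that unfolding weak_conv_on_def bounded_iff by (auto intro: exI[of _ c])
  have int_cut: "integrable M (cutoff R)" if "borel_prob_on \<Xi> M" for M R
    by (rule int[OF that meas_cont[OF that continuous_on_cutoff[of \<Xi> R]], of 1]) (auto simp: cutoff_bounds)
  have diff: "(\<lambda>\<nu>. (\<integral>z. gs \<nu> z \<partial>Ps \<nu>) - (\<integral>z. g z \<partial>Ps \<nu>)) \<longlonglongrightarrow> 0"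
  proof (cases "\<Xi> = {}")
    case True
    then show ?thesis using P.not_empty borel_prob_onD(2)[OF P] by simp
  next
    case False
    then have T: "T \<ge> 0" using g_bd by force
    show ?thesis
    proof (rule tendstoI)
      fix e' :: real assume e': "e' > 0"
      \<comment> \<open>The final bound is \<open>e + 2 * T * e\<close>; the extra \<open>e\<close> makes the inequality strict.\<close>
      define e where "e = e' / (2 + 2 * T)"
      have e: "e > 0" using e' T by (simp add: e_def)
      have "(\<lambda>R. \<integral>z. cutoff (real R) z \<partial>P) \<longlonglongrightarrow> (\<integral>z. 0 \<partial>P)"
      proof (rule integral_dominated_convergence[where w = "\<lambda>_. 1"])
        show "AE z in P. (\<lambda>R. cutoff (real R) z) \<longlonglongrightarrow> 0"
        proof (rule AE_I2)
          fix z
          have "cutoff (real R) z = 0" if "R \<ge> nat \<lceil>norm z\<rceil>" for R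
            using that unfolding cutoff_def by (simp add: nat_le_iff ceiling_le_iff)
          then have "\<forall>\<^sub>F R in sequentially. cutoff (real R) z = 0"
            unfolding eventually_sequentially by blast
          then show "(\<lambda>R. cutoff (real R) z) \<longlonglongrightarrow> 0" by (rule tendsto_eventually)
        qed
      qed (auto simp: cutoff_bounds intro!: meas_cont[OF P] continuous_on_cutoff)
      then have "\<forall>\<^sub>F R in sequentially. (\<integral>z. cutoff (real R) z \<partial>P) < e"
        by (rule order_tendstoD) (use e in simp)
      then obtain R :: nat where R: "(\<integral>z. cutoff (real R) z \<partial>P) < e"
        unfolding eventually_sequentially by blast
      have tail: "\<forall>\<^sub>F \<nu> in sequentially. (\<integral>z. cutoff (real R) z \<partial>Ps \<nu>) < e"
        by (rule order_tendstoD(2)[OF weakD[OF continuous_on_cutoff[of \<Xi> "real R"], of 1] R]) (auto simp: cutoff_bounds)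
      obtain N where N: "\<And>\<nu> w. \<nu> \<ge> N \<Longrightarrow> w \<in> \<Xi> \<inter> cball 0 (real R + 1) \<Longrightarrow> \<bar>gs \<nu> w - g w\<bar> < e"
        using uniform_on_compact[OF _ _ e joint cont, of "\<Xi> \<inter> cball 0 (real R + 1)"]
          closed_Int_compact[OF closed compact_cball] by blast
      show "\<forall>\<^sub>F \<nu> in sequentially. dist ((\<integral>z. gs \<nu> z \<partial>Ps \<nu>) - (\<integral>z. g z \<partial>Ps \<nu>)) 0 < e'"
        using tail eventually_ge_at_top[of N]
      proof eventually_elim
        case (elim \<nu>)
        interpret prob_space "Ps \<nu>" by (rule borel_prob_onD(1)[OF Ps])
        have i: "integrable (Ps \<nu>) (gs \<nu>)" "integrable (Ps \<nu>) g"
          using int[OF Ps meas bd] int[OF Ps meas_cont[OF Ps cont] g_bd] by auto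
        have "\<bar>(\<integral>z. gs \<nu> z \<partial>Ps \<nu>) - (\<integral>z. g z \<partial>Ps \<nu>)\<bar> = \<bar>\<integral>z. gs \<nu> z - g z \<partial>Ps \<nu>\<bar>"
          using i by simp
        also have "\<dots> \<le> (\<integral>z. \<bar>gs \<nu> z - g z\<bar> \<partial>Ps \<nu>)" by (rule integral_abs_bound)
        also have "\<dots> \<le> (\<integral>z. e + 2 * T * cutoff (real R) z \<partial>Ps \<nu>)"
        proof (rule integral_mono)
          show "integrable (Ps \<nu>) (\<lambda>z. \<bar>gs \<nu> z - g z\<bar>)"
            using i by (intro integrable_abs Bochner_Integration.integrable_diff)
          show "integrable (Ps \<nu>) (\<lambda>z. e + 2 * T * cutoff (real R) z)"
            using int_cut[OF Ps] by (intro Bochner_Integration.integrable_add integrable_mult_right) auto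
          fix z assume "z \<in> space (Ps \<nu>)"
          then have z: "z \<in> \<Xi>" using borel_prob_onD(2)[OF Ps] by simp
          show "\<bar>gs \<nu> z - g z\<bar> \<le> e + 2 * T * cutoff (real R) z"
          proof (cases "norm z \<le> real R + 1")
            case True
            then have "\<bar>gs \<nu> z - g z\<bar> < e" using N[OF elim(2)] z by auto
            then show ?thesis using T cutoff_bounds(1)[of "real R" z] by (simp add: add_increasing2)
          next
            case False
            then have "cutoff (real R) z = 1" by (simp add: cutoff_def)
            then show ?thesis using bd[OF z, of \<nu>] g_bd[OF z] e by simp
          qed
        qed
        also have "\<dots> = e + 2 * T * (\<integral>z. cutoff (real R) z \<partial>Ps \<nu>)"
          using int_cut[OF Ps] by (simp add: prob_space)
        also have "\<dots> \<le> e + 2 * T * e"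
          using elim(1) T by (intro add_left_mono mult_left_mono) auto
        also have "\<dots> < (2 + 2 * T) * e" using e by (simp add: algebra_simps)
        also have "\<dots> = e'" using T by (simp add: e_def)
        finally show ?case by (simp add: dist_real_def)
      qed
    qed
  qed
  from tendsto_add[OF diff weakD[OF cont g_bd]] show ?thesis by simp
qed

text \<open>This reduces extended-real expectations to Bochner integrals of real functions.\<close>

lemma ereal_integrable_imp_real:
  assumes f: "ereal_integrable M f"
  shows "AE x in M. \<bar>f x\<bar> \<noteq> \<infinity>"
    and "integrable M (\<lambda>x. real_of_ereal (f x))"
    and "ereal_expect M f = ereal (\<integral>x. real_of_ereal (f x) \<partial>M)"
proof -
  have meas[measurable]: "f \<in> borel_measurable M" and fin: "(\<integral>\<^sup>+ x. e2ennreal \<bar>f x\<bar> \<partial>M) < \<infinity>"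
    using f unfolding ereal_integrable_def by auto
  have "AE x in M. e2ennreal \<bar>f x\<bar> \<noteq> \<infinity>"
    by (rule nn_integral_PInf_AE) (use fin in auto)
  then show AE: "AE x in M. \<bar>f x\<bar> \<noteq> \<infinity>"
    by eventually_elim (auto simp: e2ennreal_infty)
  show int: "integrable M (\<lambda>x. real_of_ereal (f x))"
  proof (rule integrableI_bounded)
    have "(\<integral>\<^sup>+ x. ennreal (norm (real_of_ereal (f x))) \<partial>M) \<le> (\<integral>\<^sup>+ x. e2ennreal \<bar>f x\<bar> \<partial>M)"
    proof (rule nn_integral_mono)
      fix x
      show "ennreal (norm (real_of_ereal (f x))) \<le> e2ennreal \<bar>f x\<bar>"
        by (cases "f x") (auto simp: e2ennreal_ereal)
    qed
    then show "(\<integral>\<^sup>+ x. ennreal (norm (real_of_ereal (f x))) \<partial>M) < \<infinity>"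
      using fin by (rule le_less_trans)
  qed simp
  have pos: "(\<integral>\<^sup>+ x. e2ennreal (f x) \<partial>M) = (\<integral>\<^sup>+ x. ennreal (real_of_ereal (f x)) \<partial>M)"
    by (rule nn_integral_cong_AE, use AE in eventually_elim) (auto simp: ereal_real simp flip: e2ennreal_ereal)
  have neg: "(\<integral>\<^sup>+ x. e2ennreal (- f x) \<partial>M) = (\<integral>\<^sup>+ x. ennreal (- real_of_ereal (f x)) \<partial>M)"
    by (rule nn_integral_cong_AE, use AE in eventually_elim)
       (auto simp: ereal_real simp flip: e2ennreal_ereal uminus_ereal.simps(1))
  have "(\<integral>\<^sup>+ x. ennreal (real_of_ereal (f x)) \<partial>M) < \<top>" "(\<integral>\<^sup>+ x. ennreal (- real_of_ereal (f x)) \<partial>M) < \<top>"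
    using integrableD(2)[OF int] integrableD(3)[OF int] by (auto simp: less_top)
  then show "ereal_expect M f = ereal (\<integral>x. real_of_ereal (f x) \<partial>M)"
    unfolding ereal_expect_def pos neg real_lebesgue_integral_def[OF int]
    by (auto simp: less_top_ennreal)
qed

text \<open>The value of \<open>a\<close> truncated to the interval \<open>[-T, T]\<close>, which is real even for infinite \<open>a\<close>.\<close>

definition clamp_at :: "real \<Rightarrow> ereal \<Rightarrow> real" where
  "clamp_at T a = real_of_ereal (max (ereal (- T)) (min (ereal T) a))"

lemma ereal_clamp_at: "T \<ge> 0 \<Longrightarrow> ereal (clamp_at T a) = max (ereal (- T)) (min (ereal T) a)"
  unfolding clamp_at_def by (cases a) (auto simp: max_def min_def)

lemma clamp_at_bound: "T \<ge> 0 \<Longrightarrow> \<bar>clamp_at T a\<bar> \<le> T"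
  using ereal_clamp_at[of T a] by (cases a) (auto simp: max_def min_def split: if_splits)

lemma tendsto_clamp_at:
  assumes "T \<ge> 0" "(f \<longlongrightarrow> a) F"
  shows "((\<lambda>x. clamp_at T (f x)) \<longlongrightarrow> clamp_at T a) F"
proof -
  have "((\<lambda>x. max (ereal (- T)) (min (ereal T) (f x))) \<longlongrightarrow> max (ereal (- T)) (min (ereal T) a)) F"
    by (intro tendsto_max tendsto_min tendsto_const assms)
  then show ?thesis by (simp flip: ereal_clamp_at[OF assms(1)])
qed

lemma clamp_at_error:
  assumes "T > 0" "\<bar>a\<bar> \<noteq> \<infinity>"
  shows "real_of_ereal a \<le> clamp_at T a + real_of_ereal (a * of_bool (ereal T \<le> a))"
    and "clamp_at T a + real_of_ereal (a * of_bool (a \<le> ereal (- T))) \<le> real_of_ereal a"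
  using assms by (cases a; auto simp: clamp_at_def max_def min_def)+

lemma ereal_integrable_restrict:
  assumes f: "ereal_integrable M f" and p: "Measurable.pred M p"
  shows "ereal_integrable M (\<lambda>x. f x * of_bool (p x))"
proof -
  have meas[measurable]: "f \<in> borel_measurable M" and fin: "(\<integral>\<^sup>+ x. e2ennreal \<bar>f x\<bar> \<partial>M) < \<infinity>"
    using f unfolding ereal_integrable_def by auto
  note p[measurable]
  have eq: "(\<lambda>x. f x * of_bool (p x)) = (\<lambda>x. if p x then f x else 0)" by auto
  have "(\<integral>\<^sup>+ x. e2ennreal \<bar>if p x then f x else 0\<bar> \<partial>M) \<le> (\<integral>\<^sup>+ x. e2ennreal \<bar>f x\<bar> \<partial>M)"
    by (intro nn_integral_mono e2ennreal_mono) auto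
  then show ?thesis
    unfolding ereal_integrable_def eq using fin by (auto intro: le_less_trans)
qed

text \<open>Clamping changes the integrand only where it lies beyond \<open>- T\<close> or \<open>T\<close>, and there by no more than
  the size of the integrand itself.\<close>

lemma clamp_at_expectation:
  assumes M: "prob_space M" and f: "ereal_integrable M f" and T: "T > 0"
  shows "(\<integral>x. clamp_at T (f x) \<partial>M) + ereal_expect M (\<lambda>x. f x * of_bool (f x \<le> ereal (- T))) \<le> ereal_expect M f"
    and "ereal_expect M f \<le> (\<integral>x. clamp_at T (f x) \<partial>M) + ereal_expect M (\<lambda>x. f x * of_bool (f x \<ge> ereal T))"
proof -
  interpret prob_space M by (rule M)
  have [measurable]: "f \<in> borel_measurable M" using f unfolding ereal_integrable_def by auto
  have clamp: "integrable M (\<lambda>x. clamp_at T (f x))"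
  proof (rule integrable_const_bound[of _ T])
    show "(\<lambda>x. clamp_at T (f x)) \<in> borel_measurable M" unfolding clamp_at_def by measurable
    show "AE x in M. norm (clamp_at T (f x)) \<le> T" using clamp_at_bound[of T] T by simp
  qed
  have lo: "ereal_integrable M (\<lambda>x. f x * of_bool (f x \<le> ereal (- T)))"
    and hi: "ereal_integrable M (\<lambda>x. f x * of_bool (f x \<ge> ereal T))"
    by (rule ereal_integrable_restrict[OF f]; measurable)+
  note real = ereal_integrable_imp_real(2)
  show "(\<integral>x. clamp_at T (f x) \<partial>M) + ereal_expect M (\<lambda>x. f x * of_bool (f x \<le> ereal (- T))) \<le> ereal_expect M f"
    unfolding ereal_integrable_imp_real(3)[OF f] ereal_integrable_imp_real(3)[OF lo]
    using clamp real[OF f] real[OF lo] ereal_integrable_imp_real(1)[OF f] clamp_at_error(2)[OF T]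
    by (auto simp flip: Bochner_Integration.integral_add intro!: integral_mono_AE)
  show "ereal_expect M f \<le> (\<integral>x. clamp_at T (f x) \<partial>M) + ereal_expect M (\<lambda>x. f x * of_bool (f x \<ge> ereal T))"
    unfolding ereal_integrable_imp_real(3)[OF f] ereal_integrable_imp_real(3)[OF hi]
    using clamp real[OF f] real[OF hi] ereal_integrable_imp_real(1)[OF f] clamp_at_error(1)[OF T]
    by (auto simp flip: Bochner_Integration.integral_add intro!: integral_mono_AE)
qed

lemma clamp_at_expectation_limit:
  assumes f: "ereal_integrable M f"
  shows "(\<lambda>n. \<integral>x. clamp_at (real n) (f x) \<partial>M) \<longlonglongrightarrow> (\<integral>x. real_of_ereal (f x) \<partial>M)"
proof (rule integral_dominated_convergence[where w = "\<lambda>x. \<bar>real_of_ereal (f x)\<bar>"])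
  have [measurable]: "f \<in> borel_measurable M" using f unfolding ereal_integrable_def by auto
  show "(\<lambda>x. clamp_at (real n) (f x)) \<in> borel_measurable M" for n
    unfolding clamp_at_def by measurable
  show "(\<lambda>x. real_of_ereal (f x)) \<in> borel_measurable M" by measurable
  show "integrable M (\<lambda>x. \<bar>real_of_ereal (f x)\<bar>)"
    using ereal_integrable_imp_real(2)[OF f] by (rule integrable_abs)
  show "AE x in M. (\<lambda>n. clamp_at (real n) (f x)) \<longlonglongrightarrow> real_of_ereal (f x)"
    using ereal_integrable_imp_real(1)[OF f]
  proof eventually_elim
    case (elim x)
    then obtain r where r: "f x = ereal r" by auto
    have "clamp_at (real n) (f x) = r" if "n \<ge> nat \<lceil>\<bar>r\<bar>\<rceil>" for n
    proof -
      have "\<bar>r\<bar> \<le> real n" using that by (simp add: nat_le_iff ceiling_le_iff)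
      then show ?thesis by (auto simp: r clamp_at_def max_def min_def)
    qed
    then have "\<forall>\<^sub>F n in sequentially. clamp_at (real n) (f x) = real_of_ereal (f x)"
      unfolding eventually_sequentially r real_of_ereal.simps by blast
    then show ?case by (rule tendsto_eventually)
  qed
  show "AE x in M. norm (clamp_at (real n) (f x)) \<le> \<bar>real_of_ereal (f x)\<bar>" for n
    using ereal_integrable_imp_real(1)[OF f]
    by eventually_elim (auto simp: clamp_at_def max_def min_def)
qed

text \<open>Clamping to \<open>[-n, n]\<close> reduces the claim to bounded integrands. The errors committed are bounded by
  the expectations over the values beyond \<open>- n\<close> and \<open>n\<close>, which the last two hypotheses make small for
  large \<open>n\<close> and all late \<open>\<nu>\<close>.\<close>

theorem expectation_limit:
  fixes f :: "'a::euclidean_space \<Rightarrow> ereal"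
  assumes closed: "closed \<Xi>" and P: "borel_prob_on \<Xi> P" and Ps: "\<And>\<nu>. borel_prob_on \<Xi> (Ps \<nu>)"
    and weak: "weak_conv_on \<Xi> Ps P"
    and int: "ereal_integrable P f" and ints: "\<And>\<nu>. ereal_integrable (Ps \<nu>) (fs \<nu>)"
    and lower: "lower_limit \<Xi> fs f" and upper: "lower_limit \<Xi> (\<lambda>\<nu> z. - fs \<nu> z) (\<lambda>z. - f z)"
    and lo: "0 \<le> Liminf at_bot (\<lambda>\<tau>::real. liminf (\<lambda>\<nu>.
      ereal_expect (Ps \<nu>) (\<lambda>z. fs \<nu> z * of_bool (fs \<nu> z \<le> ereal \<tau>))))"
    and hi: "Limsup at_top (\<lambda>\<tau>::real. limsup (\<lambda>\<nu>.
      ereal_expect (Ps \<nu>) (\<lambda>z. fs \<nu> z * of_bool (fs \<nu> z \<ge> ereal \<tau>)))) \<le> 0"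
  shows "(\<lambda>\<nu>. ereal_expect (Ps \<nu>) (fs \<nu>)) \<longlonglongrightarrow> ereal_expect P f"
proof -
  define I where "I = (\<integral>x. real_of_ereal (f x) \<partial>P)"
  define Is where "Is \<nu> = (\<integral>x. real_of_ereal (fs \<nu> x) \<partial>Ps \<nu>)" for \<nu>
  have exp: "ereal_expect P f = ereal I" "ereal_expect (Ps \<nu>) (fs \<nu>) = ereal (Is \<nu>)" for \<nu>
    using ereal_integrable_imp_real(3)[OF int] ereal_integrable_imp_real(3)[OF ints]
    by (auto simp: I_def Is_def)
  have "Is \<longlonglongrightarrow> I"
  proof (rule tendstoI)
    fix e' :: real assume "e' > 0"
    \<comment> \<open>One third each for the clamping error of \<open>fs \<nu>\<close>, that of \<open>f\<close>, and the clamped expectations.\<close>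
    define e where "e = e' / 3"
    have e: "e > 0" using \<open>e' > 0\<close> by (simp add: e_def)
    have real_n: "filterlim real at_top sequentially" by (rule filterlim_real_sequentially)
    have "\<forall>\<^sub>F \<tau>::real in at_bot. ereal (- e) < liminf (\<lambda>\<nu>.
        ereal_expect (Ps \<nu>) (\<lambda>z. fs \<nu> z * of_bool (fs \<nu> z \<le> ereal \<tau>)))"
      by (rule less_LiminfD, rule less_le_trans[OF _ lo]) (use e in simp)
    then have 1: "\<forall>\<^sub>F n in sequentially. ereal (- e) < liminf (\<lambda>\<nu>.
        ereal_expect (Ps \<nu>) (\<lambda>z. fs \<nu> z * of_bool (fs \<nu> z \<le> ereal (- real n))))"
      by (rule eventually_compose_filterlim)
         (use real_n in \<open>simp add: filterlim_uminus_at_top[symmetric]\<close>)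
    have "\<forall>\<^sub>F \<tau>::real in at_top. limsup (\<lambda>\<nu>.
        ereal_expect (Ps \<nu>) (\<lambda>z. fs \<nu> z * of_bool (fs \<nu> z \<ge> ereal \<tau>))) < ereal e"
      by (rule Limsup_lessD, rule le_less_trans[OF hi]) (use e in simp)
    then have 2: "\<forall>\<^sub>F n in sequentially. limsup (\<lambda>\<nu>.
        ereal_expect (Ps \<nu>) (\<lambda>z. fs \<nu> z * of_bool (fs \<nu> z \<ge> ereal (real n)))) < ereal e"
      by (rule eventually_compose_filterlim) (rule real_n)
    have 3: "\<forall>\<^sub>F n in sequentially. dist (\<integral>x. clamp_at (real n) (f x) \<partial>P) I < e"
      unfolding I_def by (rule tendstoD[OF clamp_at_expectation_limit[OF int] e])
    have "\<exists>n. n > 0 \<and> ereal (- e) < liminf (\<lambda>\<nu>.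
        ereal_expect (Ps \<nu>) (\<lambda>z. fs \<nu> z * of_bool (fs \<nu> z \<le> ereal (- real n)))) \<and>
      limsup (\<lambda>\<nu>. ereal_expect (Ps \<nu>) (\<lambda>z. fs \<nu> z * of_bool (fs \<nu> z \<ge> ereal (real n)))) < ereal e \<and>
      dist (\<integral>x. clamp_at (real n) (f x) \<partial>P) I < e"
      by (rule eventually_happens'[OF sequentially_bot])
         (use eventually_gt_at_top[of 0] 1 2 3 in \<open>auto intro!: eventually_conj\<close>)
    then obtain n where n: "n > 0"
      and n_lo: "ereal (- e) < liminf (\<lambda>\<nu>.
        ereal_expect (Ps \<nu>) (\<lambda>z. fs \<nu> z * of_bool (fs \<nu> z \<le> ereal (- real n))))"
      and n_hi: "limsup (\<lambda>\<nu>. ereal_expect (Ps \<nu>) (\<lambda>z. fs \<nu> z * of_bool (fs \<nu> z \<ge> ereal (real n)))) < ereal e"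
      and n_f: "dist (\<integral>x. clamp_at (real n) (f x) \<partial>P) I < e"
      by blast
    have "(\<lambda>\<nu>. \<integral>x. clamp_at (real n) (fs \<nu> x) \<partial>Ps \<nu>) \<longlonglongrightarrow> (\<integral>x. clamp_at (real n) (f x) \<partial>P)"
    proof (rule bounded_expectation_limit[OF closed P Ps weak])
      show "(\<lambda>x. clamp_at (real n) (fs \<nu> x)) \<in> borel_measurable (Ps \<nu>)" for \<nu>
      proof -
        have [measurable]: "fs \<nu> \<in> borel_measurable (Ps \<nu>)" using ints unfolding ereal_integrable_def by auto
        show ?thesis unfolding clamp_at_def by measurable
      qed
      show "\<bar>clamp_at (real n) (fs \<nu> z)\<bar> \<le> real n" for \<nu> z by (rule clamp_at_bound) simp
      fix z assume z: "z \<in> \<Xi>"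
      show "((\<lambda>(\<nu>, w). clamp_at (real n) (fs \<nu> w)) \<longlongrightarrow> clamp_at (real n) (f z)) (joint_filter z \<Xi>)"
        using tendsto_clamp_at[OF _ lower_limit_tendsto_joint[OF lower upper z], of "real n"]
        by (simp add: case_prod_unfold)
    qed
    from tendstoD[OF this e]
    have "\<forall>\<^sub>F \<nu> in sequentially.
      dist (\<integral>x. clamp_at (real n) (fs \<nu> x) \<partial>Ps \<nu>) (\<integral>x. clamp_at (real n) (f x) \<partial>P) < e" .
    with less_LiminfD[OF n_lo] Limsup_lessD[OF n_hi]
    show "\<forall>\<^sub>F \<nu> in sequentially. dist (Is \<nu>) I < e'"
    proof eventually_elim
      case (elim \<nu>)
      define c where "c = (\<integral>x. clamp_at (real n) (fs \<nu> x) \<partial>Ps \<nu>)"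
      note bounds = clamp_at_expectation[OF borel_prob_onD(1)[OF Ps[of \<nu>]] ints[of \<nu>], of "real n", folded c_def, unfolded exp(2)]
      have "ereal (c + - e) \<le> ereal c + ereal_expect (Ps \<nu>) (\<lambda>z. fs \<nu> z * of_bool (fs \<nu> z \<le> ereal (- real n)))"
        using elim(1) unfolding plus_ereal.simps(1)[symmetric] by (intro add_left_mono less_imp_le)
      also have "\<dots> \<le> ereal (Is \<nu>)" using bounds(1) n by simp
      finally have 1: "c - e \<le> Is \<nu>" by simp
      have "ereal (Is \<nu>) \<le> ereal c + ereal_expect (Ps \<nu>) (\<lambda>z. fs \<nu> z * of_bool (fs \<nu> z \<ge> ereal (real n)))"
        using bounds(2) n by simp
      also have "\<dots> \<le> ereal (c + e)"
        using elim(2) unfolding plus_ereal.simps(1)[symmetric] by (intro add_left_mono less_imp_le)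
      finally have 2: "Is \<nu> \<le> c + e" by simp
      show ?case using 1 2 elim(3) n_f e_def unfolding c_def[symmetric] dist_real_def by linarith
    qed
  qed
  then show ?thesis unfolding exp by simp
qed

section \<open>Bellman operators along epi-convergent sequences\<close>

text \<open>The real first term keeps the sum meaningful when \<open>v\<close> is infinite, so the slack between \<open>a\<close> and
  the objective can be shared between the two terms.\<close>

lemma less_bellman_obj_split:
  assumes "a < ereal p + ereal \<beta> * v" "\<beta> > 0"
  obtains p' v' where "p' < p" "ereal v' < v" "a < ereal (p' + \<beta> * v')"
proof -
  obtain c where c: "a < ereal c" "ereal c < ereal p + ereal \<beta> * v"
    using ereal_dense2[OF assms(1)] by blast
  show thesis
  proof (cases v)
    case (real r)
    define d where "d = p + \<beta> * r - c"
    have "d > 0" using c(2) by (simp add: real d_def)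
    then show thesis
      using c(1) assms(2) by (intro that[of "p - d / 2" "r - d / (2 * \<beta>)"])
        (auto simp: real d_def field_simps)
  next
    case PInf
    then show thesis
      using c(1) assms(2) by (intro that[of "p - 1" "(c - (p - 1)) / \<beta>"]) auto
  next
    case MInf
    then show thesis using c(2) assms(2) by simp
  qed
qed

lemma lower_limit_bellman_obj:
  fixes X :: "'a::metric_space set" and \<Xi> :: "'b::metric_space set"
  assumes \<beta>: "\<beta> > 0" and C: "C \<subseteq> X" and x: "x \<in> X" "\<xi> \<in> \<Xi>"
    and \<phi>: "lower_limit (X \<times> X \<times> \<Xi>) (\<lambda>\<nu> z. ereal (\<phi>s \<nu> z)) (\<lambda>z. ereal (\<phi> z))"
    and W: "lower_limit X Ws V"
  shows "lower_limit C (\<lambda>\<nu>. bellman_obj \<beta> (\<phi>s \<nu>) (Ws \<nu>) x \<xi>) (bellman_obj \<beta> \<phi> V x \<xi>)"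
  unfolding lower_limit_def
proof (intro ballI allI impI)
  fix y a assume "y \<in> C" and a: "a < bellman_obj \<beta> \<phi> V x \<xi> y"
  then have y: "y \<in> X" using C by blast
  obtain p v where p: "p < \<phi> (x, y, \<xi>)" and v: "ereal v < V y" and av: "a < ereal (p + \<beta> * v)"
    using less_bellman_obj_split[OF a[unfolded bellman_obj_def] \<beta>] .
  have pt: "(x, y, \<xi>) \<in> X \<times> X \<times> \<Xi>" "ereal p < ereal (\<phi> (x, y, \<xi>))" using x y p by auto
  obtain N1 \<delta>1 where 1: "\<delta>1 > 0" "\<And>\<nu> z. \<nu> \<ge> N1 \<Longrightarrow> z \<in> X \<times> X \<times> \<Xi> \<Longrightarrow>
      dist z (x, y, \<xi>) < \<delta>1 \<Longrightarrow> ereal p < ereal (\<phi>s \<nu> z)"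
    using lower_limitD[OF \<phi> pt] by metis
  obtain N2 \<delta>2 where 2: "\<delta>2 > 0" "\<And>\<nu> w. \<nu> \<ge> N2 \<Longrightarrow> w \<in> X \<Longrightarrow> dist w y < \<delta>2 \<Longrightarrow> ereal v < Ws \<nu> w"
    using lower_limitD[OF W y v] by metis
  have "a < bellman_obj \<beta> (\<phi>s \<nu>) (Ws \<nu>) x \<xi> w"
    if that: "\<nu> \<ge> max N1 N2" "w \<in> C" "dist w y < min \<delta>1 \<delta>2" for \<nu> w
  proof -
    have w: "w \<in> X" using that C by blast
    have "dist (x, w, \<xi>) (x, y, \<xi>) = dist w y" by (simp add: dist_Pair_Pair)
    then have "p < \<phi>s \<nu> (x, w, \<xi>)" using 1(2)[of \<nu> "(x, w, \<xi>)"] x w that by simp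
    moreover have "ereal v < Ws \<nu> w" using 2(2)[of \<nu> w] w that by simp
    ultimately have "ereal (p + \<beta> * v) \<le> ereal (\<phi>s \<nu> (x, w, \<xi>)) + ereal \<beta> * Ws \<nu> w"
      using \<beta> by (cases "Ws \<nu> w") (auto intro!: add_mono mult_left_mono)
    then show ?thesis using av unfolding bellman_obj_def by simp
  qed
  then show "\<exists>N. \<exists>\<delta>>0. \<forall>\<nu>\<ge>N. \<forall>w\<in>C. dist w y < \<delta> \<longrightarrow> a < bellman_obj \<beta> (\<phi>s \<nu>) (Ws \<nu>) x \<xi> w"
    using 1(1) 2(1) by (intro exI[of _ "max N1 N2"] exI[of _ "min \<delta>1 \<delta>2"]) auto
qed

lemma tendsto_bellman_obj:
  assumes "(\<lambda>\<nu>. \<phi>s \<nu> (x, y, \<xi>)) \<longlonglongrightarrow> \<phi> (x, y, \<xi>)" "(\<lambda>\<nu>. Ws \<nu> y) \<longlonglongrightarrow> V y"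
  shows "(\<lambda>\<nu>. bellman_obj \<beta> (\<phi>s \<nu>) (Ws \<nu>) x \<xi> y) \<longlonglongrightarrow> bellman_obj \<beta> \<phi> V x \<xi> y"
  unfolding bellman_obj_def using assms
  by (intro tendsto_add_ereal_general2 tendsto_cmult_ereal) auto

lemma lower_limit_slice:
  fixes X :: "'a::metric_space set" and Z :: "'b::metric_space set"
  assumes "lower_limit (X \<times> Z) (\<lambda>\<nu> (x, z). fs \<nu> x z) (\<lambda>(x, z). f x z)" "x \<in> X"
  shows "lower_limit Z (\<lambda>\<nu>. fs \<nu> x) (f x)"
  unfolding lower_limit_def
proof (intro ballI allI impI)
  fix z a assume "z \<in> Z" "a < f x z"
  then have pt: "(x, z) \<in> X \<times> Z" "a < (case (x, z) of (x, z) \<Rightarrow> f x z)" using assms(2) by auto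
  obtain N \<delta> where \<delta>: "\<delta> > 0"
    and N: "\<And>\<nu> p. \<nu> \<ge> N \<Longrightarrow> p \<in> X \<times> Z \<Longrightarrow> dist p (x, z) < \<delta> \<Longrightarrow> a < (case p of (x, z) \<Rightarrow> fs \<nu> x z)"
    using lower_limitD[OF assms(1) pt] by metis
  have "a < fs \<nu> x w" if "\<nu> \<ge> N" "w \<in> Z" "dist w z < \<delta>" for \<nu> w
    using N[of \<nu> "(x, w)"] that assms(2) by (simp add: dist_Pair_Pair)
  with \<delta> show "\<exists>N. \<exists>\<delta>>0. \<forall>\<nu>\<ge>N. \<forall>w\<in>Z. dist w z < \<delta> \<longrightarrow> a < fs \<nu> x w" by blast
qed

text \<open>The joint limit inferior includes the constant choice \<open>w = x\<close>.\<close>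

lemma Liminf_joint_le_liminf:
  fixes h :: "nat \<Rightarrow> 'a::metric_space \<Rightarrow> ereal"
  assumes "x \<in> X"
  shows "Liminf (sequentially \<times>\<^sub>F inf (nhds x) (principal X)) (\<lambda>(\<nu>, w). h \<nu> w) \<le> liminf (\<lambda>\<nu>. h \<nu> x)"
  unfolding le_Liminf_iff
proof (intro allI impI)
  fix a assume "a < Liminf (sequentially \<times>\<^sub>F inf (nhds x) (principal X)) (\<lambda>(\<nu>, w). h \<nu> w)"
  then have "\<forall>\<^sub>F p in joint_filter x X. a < (case p of (\<nu>, w) \<Rightarrow> h \<nu> w)"
    unfolding joint_filter_def by (rule less_LiminfD)
  then obtain N \<delta> where "\<delta> > 0" "\<And>\<nu> w. \<nu> \<ge> N \<Longrightarrow> w \<in> X \<Longrightarrow> dist w x < \<delta> \<Longrightarrow> a < h \<nu> w"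
    unfolding eventually_joint_filter by auto
  then show "\<forall>\<^sub>F \<nu> in sequentially. a < h \<nu> x"
    unfolding eventually_sequentially using assms by (intro exI[of _ N]) simp
qed

theorem proposition2:
  fixes X :: "(real ^ 'n) set" and \<Xi> :: "(real ^ 'm) set"
    and \<beta> :: real
    and Y :: "real ^ 'n \<Rightarrow> real ^ 'm \<Rightarrow> (real ^ 'n) set"
    and \<phi> :: "(real ^ 'n) \<times> (real ^ 'n) \<times> (real ^ 'm) \<Rightarrow> real"
    and \<phi>s :: "nat \<Rightarrow> (real ^ 'n) \<times> (real ^ 'n) \<times> (real ^ 'm) \<Rightarrow> real"
    and P :: "(real ^ 'm) measure" and Ps :: "nat \<Rightarrow> (real ^ 'm) measure"
    and zctr :: "(real ^ 'n) \<times> real"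
    and \<V> :: "(real ^ 'n \<Rightarrow> ereal) set"
    and Vs :: "nat \<Rightarrow> real ^ 'n \<Rightarrow> ereal"
  assumes closed_X: "closed X" and closed_Xi: "closed \<Xi>"
    and beta: "0 < \<beta>" "\<beta> < 1"
    and Y: "\<And>x \<xi>. x \<in> X \<Longrightarrow> \<xi> \<in> \<Xi> \<Longrightarrow> Y x \<xi> \<subseteq> X \<and> Y x \<xi> \<noteq> {} \<and> compact (Y x \<xi>)"
    and P: "borel_prob_on \<Xi> P" and Ps: "\<And>\<nu>. borel_prob_on \<Xi> (Ps \<nu>)"
    and zctr: "zctr \<in> X \<times> UNIV"
    and V_lsc: "\<V> \<subseteq> lsc_fcns X"
    and reg_int: "\<And>V x. V \<in> \<V> \<Longrightarrow> x \<in> X \<Longrightarrow> ereal_integrable P (\<lambda>\<xi>. bellman_inf \<beta> \<phi> Y V x \<xi>)"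
    and reg_map: "\<And>V. V \<in> \<V> \<Longrightarrow> bellman X P \<beta> \<phi> Y V \<in> \<V>"
    and regs_int: "\<And>\<nu> V x. V \<in> \<V> \<Longrightarrow> x \<in> X \<Longrightarrow>
      ereal_integrable (Ps \<nu>) (\<lambda>\<xi>. bellman_inf \<beta> (\<phi>s \<nu>) Y V x \<xi>)"
    and regs_map: "\<And>\<nu> V. V \<in> \<V> \<Longrightarrow> bellman X (Ps \<nu>) \<beta> (\<phi>s \<nu>) Y V \<in> \<V>"
    and weak: "weak_conv_on \<Xi> Ps P"
    and phi_epi: "epi_conv (X \<times> X \<times> \<Xi>) (\<lambda>\<nu> z. ereal (\<phi>s \<nu> z)) (\<lambda>z. ereal (\<phi> z))"
    and phi_pt: "\<And>z. z \<in> X \<times> X \<times> \<Xi> \<Longrightarrow> (\<lambda>\<nu>. \<phi>s \<nu> z) \<longlonglongrightarrow> \<phi> z"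
    and V_compact: "compactin (Metric_space.mtopology (lsc_fcns X) (aw_dist X zctr)) \<V>"
    and seqs: "\<And>W. (\<And>\<nu>. W \<nu> \<in> \<V>) \<Longrightarrow> (\<exists>W\<^sub>0\<in>fcns X. epi_conv X W W\<^sub>0) \<Longrightarrow>
      equi_lsc X W \<and>
      (\<forall>xb\<in>X.
        (Liminf at_bot (\<lambda>\<tau>::real.
           Liminf (sequentially \<times>\<^sub>F inf (nhds xb) (principal X)) (\<lambda>(\<nu>, x).
             ereal_expect (Ps \<nu>) (\<lambda>\<xi>. bellman_inf \<beta> (\<phi>s \<nu>) Y (W \<nu>) x \<xi>
               * of_bool (bellman_inf \<beta> (\<phi>s \<nu>) Y (W \<nu>) x \<xi> \<le> ereal \<tau>)))) = 0 \<and>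
         (\<forall>\<nu>. lsc_on (X \<times> \<Xi>) (\<lambda>(x, \<xi>). bellman_inf \<beta> (\<phi>s \<nu>) Y (W \<nu>) x \<xi>)) \<and>
         equi_lsc (X \<times> \<Xi>) (\<lambda>\<nu> (x, \<xi>). bellman_inf \<beta> (\<phi>s \<nu>) Y (W \<nu>) x \<xi>)) \<and>
        (Limsup at_top (\<lambda>\<tau>::real. limsup (\<lambda>\<nu>.
             ereal_expect (Ps \<nu>) (\<lambda>\<xi>. bellman_inf \<beta> (\<phi>s \<nu>) Y (W \<nu>) xb \<xi>
               * of_bool (bellman_inf \<beta> (\<phi>s \<nu>) Y (W \<nu>) xb \<xi> \<ge> ereal \<tau>)))) = 0 \<and>
         (\<forall>\<nu>. usc_on \<Xi> (\<lambda>\<xi>. bellman_inf \<beta> (\<phi>s \<nu>) Y (W \<nu>) xb \<xi>)) \<and>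
         equi_usc \<Xi> (\<lambda>\<nu> \<xi>. bellman_inf \<beta> (\<phi>s \<nu>) Y (W \<nu>) xb \<xi>)))"
    and Vs_in: "\<And>\<nu>. Vs \<nu> \<in> \<V>"
    and Vs_fix: "\<And>\<nu>. aw_dist X zctr (Vs \<nu>) (bellman X (Ps \<nu>) \<beta> (\<phi>s \<nu>) Y (Vs \<nu>)) = 0"
  shows "(\<forall>r V. strict_mono r \<and> V \<in> fcns X \<and> epi_conv X (\<lambda>k. Vs (r k)) V \<longrightarrow>
      aw_dist X zctr V (bellman X P \<beta> \<phi> Y V) = 0 \<and>
      (\<forall>x\<in>X. \<forall>\<xi>\<in>\<Xi>.
        LimOut (\<lambda>k. argmin_on (Y x \<xi>) (bellman_obj \<beta> (\<phi>s (r k)) (Vs (r k)) x \<xi>))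
          \<subseteq> argmin_on (Y x \<xi>) (bellman_obj \<beta> \<phi> V x \<xi>) \<and>
        argmin_on (Y x \<xi>) (bellman_obj \<beta> \<phi> V x \<xi>) \<noteq> {})) \<and>
    (\<forall>V\<in>\<V>. aw_dist X zctr V (bellman X P \<beta> \<phi> Y V) = 0 \<and>
        (\<forall>V'\<in>\<V>. aw_dist X zctr V' (bellman X P \<beta> \<phi> Y V') = 0 \<longrightarrow> V' = V) \<longrightarrow>
      (\<forall>x\<in>X. \<forall>\<xi>\<in>\<Xi>.
        LimOut (\<lambda>\<nu>. argmin_on (Y x \<xi>) (bellman_obj \<beta> (\<phi>s \<nu>) (Vs \<nu>) x \<xi>))
          \<subseteq> argmin_on (Y x \<xi>) (bellman_obj \<beta> \<phi> V x \<xi>) \<and>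
        argmin_on (Y x \<xi>) (bellman_obj \<beta> \<phi> V x \<xi>) \<noteq> {}))"
proof -
  interpret AW: aw_metric X zctr by unfold_locales (use closed_X zctr in auto)
  have lsc: "V \<in> lsc_fcns X" "lsc_on X V" "V \<in> fcns X" if "V \<in> \<V>" for V
    using that V_lsc by (auto simp: lsc_fcns_def)
  have fixpoint: "Vs \<nu> = bellman X (Ps \<nu>) \<beta> (\<phi>s \<nu>) Y (Vs \<nu>)" for \<nu>
    by (rule AW.aw_dist_zero_imp_eq[OF _ _ Vs_fix]) (use lsc(1) Vs_in regs_map in auto)
  have \<phi>_lower: "lower_limit (X \<times> X \<times> \<Xi>) (\<lambda>\<nu> z. ereal (\<phi>s \<nu> z)) (\<lambda>z. ereal (\<phi> z))"
    by (rule epi_conv_imp_lower_limit[OF phi_epi])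
  have Y_sub: "Y x \<xi> \<subseteq> X" "Y x \<xi> \<noteq> {}" "compact (Y x \<xi>)" if "x \<in> X" "\<xi> \<in> \<Xi>" for x \<xi>
    using Y[OF that] by auto
  have part1: "V = bellman X P \<beta> \<phi> Y V \<and> (\<forall>x\<in>X. \<forall>\<xi>\<in>\<Xi>.
        LimOut (\<lambda>k. argmin_on (Y x \<xi>) (bellman_obj \<beta> (\<phi>s (r k)) (Vs (r k)) x \<xi>))
          \<subseteq> argmin_on (Y x \<xi>) (bellman_obj \<beta> \<phi> V x \<xi>) \<and>
        argmin_on (Y x \<xi>) (bellman_obj \<beta> \<phi> V x \<xi>) \<noteq> {})"
    if r: "strict_mono r" and V: "V \<in> fcns X" and epi: "epi_conv X (\<lambda>k. Vs (r k)) V" for r V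
  proof -
    \<comment> \<open>Compactness yields a further subsequence with an epi-limit in \<open>\<V>\<close>, which can only be \<open>V\<close>.\<close>
    have V_in: "V \<in> \<V>"
    proof -
      obtain s V' where s: "strict_mono s" and V': "V' \<in> \<V>"
        and epi': "epi_conv X (\<lambda>k. Vs (r (s k))) V'"
        using AW.compact_imp_epi_conv_subseq[OF V_compact, of "\<lambda>k. Vs (r k)"] Vs_in by blast
      have "V = V'"
      proof (rule extensionalityI)
        show "V \<in> extensional X" "V' \<in> extensional X"
          using V lsc(3)[OF V'] by (auto simp: fcns_def)
        show "V x = V' x" if "x \<in> X" for x
          by (rule epi_conv_unique[OF epi_conv_subseq[OF epi s] epi' that])
      qed
      then show ?thesis using V' by simp
    qed
    \<comment> \<open>Off the subsequence \<open>W\<close> equals \<open>V\<close>, so that index \<open>\<nu>\<close> of \<open>W\<close> meets index \<open>\<nu>\<close> of the operators.\<close>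
    define W where "W = (\<lambda>\<nu>. if \<nu> \<in> range r then Vs \<nu> else V)"
    have W_r: "W (r k) = Vs (r k)" for k by (simp add: W_def)
    have W_in: "W \<nu> \<in> \<V>" for \<nu> using V_in Vs_in by (simp add: W_def)
    have W_epi: "epi_conv X W V"
      unfolding W_def by (rule epi_conv_interleave[OF r epi lsc(2)[OF V_in]])
    have W_lower: "lower_limit X W V" by (rule epi_conv_imp_lower_limit[OF W_epi])
    have "\<exists>W\<^sub>0\<in>fcns X. epi_conv X W W\<^sub>0" using W_epi V by blast
    note W_seqs = seqs[OF W_in this]
    have W_pt: "(\<lambda>\<nu>. W \<nu> x) \<longlonglongrightarrow> V x" if "x \<in> X" for x
      by (rule equi_lsc_epi_conv_imp_pointwise[OF conjunct1[OF W_seqs] W_epi that])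
    have obj_lower: "lower_limit (Y x \<xi>) (\<lambda>\<nu>. bellman_obj \<beta> (\<phi>s \<nu>) (W \<nu>) x \<xi>) (bellman_obj \<beta> \<phi> V x \<xi>)"
      if "x \<in> X" "\<xi> \<in> \<Xi>" for x \<xi>
      by (rule lower_limit_bellman_obj[OF beta(1) Y_sub(1)[OF that] that \<phi>_lower W_lower])
    have obj_pt: "(\<lambda>\<nu>. bellman_obj \<beta> (\<phi>s \<nu>) (W \<nu>) x \<xi> y) \<longlonglongrightarrow> bellman_obj \<beta> \<phi> V x \<xi> y"
      if "x \<in> X" "\<xi> \<in> \<Xi>" "y \<in> Y x \<xi>" for x \<xi> y
      using that Y_sub(1)[of x \<xi>] by (intro tendsto_bellman_obj phi_pt W_pt) auto
    define b where "b \<nu> = bellman_inf \<beta> (\<phi>s \<nu>) Y (W \<nu>)" for \<nu>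
    define b0 where "b0 = bellman_inf \<beta> \<phi> Y V"
    have b_pt: "(\<lambda>\<nu>. b \<nu> x \<xi>) \<longlonglongrightarrow> b0 x \<xi>" if "x \<in> X" "\<xi> \<in> \<Xi>" for x \<xi>
      unfolding b_def b0_def bellman_inf_def
      by (rule tendsto_INF_compact[OF Y_sub(3)[OF that] obj_lower[OF that] obj_pt[OF that]])
    have lim: "(\<lambda>\<nu>. ereal_expect (Ps \<nu>) (b \<nu> x)) \<longlonglongrightarrow> ereal_expect P (b0 x)" if x: "x \<in> X" for x
    proof (rule expectation_limit[OF closed_Xi P Ps weak])
      show "ereal_integrable P (b0 x)" unfolding b0_def by (rule reg_int[OF V_in x])
      show "ereal_integrable (Ps \<nu>) (b \<nu> x)" for \<nu> unfolding b_def by (rule regs_int[OF W_in x])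
      note x_seqs = conjunct2[OF W_seqs, rule_format, OF x, folded b_def]
      \<comment> \<open>Equi-lower semicontinuity is given jointly in \<open>(x, \<xi>)\<close>, so the lower limit is first taken on the product and then sliced.\<close>
      have "lower_limit (X \<times> \<Xi>) (\<lambda>\<nu> (x, \<xi>). b \<nu> x \<xi>) (\<lambda>(x, \<xi>). b0 x \<xi>)"
        by (rule equi_lsc_imp_lower_limit) (use x_seqs b_pt in auto)
      from lower_limit_slice[OF this x] show "lower_limit \<Xi> (\<lambda>\<nu>. b \<nu> x) (b0 x)" .
      show "lower_limit \<Xi> (\<lambda>\<nu> \<xi>. - b \<nu> x \<xi>) (\<lambda>\<xi>. - b0 x \<xi>)"
      proof (rule equi_lsc_imp_lower_limit)
        show "equi_lsc \<Xi> (\<lambda>\<nu> \<xi>. - b \<nu> x \<xi>)" using x_seqs unfolding equi_usc_def by blast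
        show "(\<lambda>\<nu>. - b \<nu> x \<xi>) \<longlonglongrightarrow> - b0 x \<xi>" if "\<xi> \<in> \<Xi>" for \<xi>
          by (rule tendsto_uminus_ereal[OF b_pt[OF x that]])
      qed
      have "0 = Liminf at_bot (\<lambda>\<tau>::real. Liminf (sequentially \<times>\<^sub>F inf (nhds x) (principal X)) (\<lambda>(\<nu>, w).
          ereal_expect (Ps \<nu>) (\<lambda>\<xi>. b \<nu> w \<xi> * of_bool (b \<nu> w \<xi> \<le> ereal \<tau>))))"
        using x_seqs by simp
      also have "\<dots> \<le> Liminf at_bot (\<lambda>\<tau>::real. liminf (\<lambda>\<nu>.
          ereal_expect (Ps \<nu>) (\<lambda>\<xi>. b \<nu> x \<xi> * of_bool (b \<nu> x \<xi> \<le> ereal \<tau>))))"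
        by (intro Liminf_mono always_eventually allI Liminf_joint_le_liminf[OF x])
      finally show "0 \<le> Liminf at_bot (\<lambda>\<tau>::real. liminf (\<lambda>\<nu>.
          ereal_expect (Ps \<nu>) (\<lambda>\<xi>. b \<nu> x \<xi> * of_bool (b \<nu> x \<xi> \<le> ereal \<tau>))))" .
      show "Limsup at_top (\<lambda>\<tau>::real. limsup (\<lambda>\<nu>.
          ereal_expect (Ps \<nu>) (\<lambda>\<xi>. b \<nu> x \<xi> * of_bool (ereal \<tau> \<le> b \<nu> x \<xi>)))) \<le> 0"
        using x_seqs by simp
    qed
    have "V = bellman X P \<beta> \<phi> Y V"
    proof (rule extensionalityI)
      show "V \<in> extensional X" using V by (auto simp: fcns_def)
      show "bellman X P \<beta> \<phi> Y V \<in> extensional X" by (simp add: bellman_def)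
      fix x assume x: "x \<in> X"
      have "(\<lambda>k. ereal_expect (Ps (r k)) (b (r k) x)) \<longlonglongrightarrow> bellman X P \<beta> \<phi> Y V x"
        using LIMSEQ_subseq_LIMSEQ[OF lim[OF x] r] x by (simp add: comp_def bellman_def b0_def)
      moreover have "ereal_expect (Ps (r k)) (b (r k) x) = W (r k) x" for k
        using fun_cong[OF fixpoint[of "r k"], of x] x by (simp add: W_r b_def bellman_def)
      ultimately have "(\<lambda>k. W (r k) x) \<longlonglongrightarrow> bellman X P \<beta> \<phi> Y V x" by simp
      with LIMSEQ_subseq_LIMSEQ[OF W_pt[OF x] r] show "V x = bellman X P \<beta> \<phi> Y V x"
        unfolding comp_def by (rule LIMSEQ_unique)
    qed
    moreover have "LimOut (\<lambda>k. argmin_on (Y x \<xi>) (bellman_obj \<beta> (\<phi>s (r k)) (Vs (r k)) x \<xi>))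
          \<subseteq> argmin_on (Y x \<xi>) (bellman_obj \<beta> \<phi> V x \<xi>)" if "x \<in> X" "\<xi> \<in> \<Xi>" for x \<xi>
    proof -
      have "LimOut (\<lambda>k. argmin_on (Y x \<xi>) (bellman_obj \<beta> (\<phi>s (r k)) (W (r k)) x \<xi>))
          \<subseteq> argmin_on (Y x \<xi>) (bellman_obj \<beta> \<phi> V x \<xi>)"
        by (rule LimOut_argmin_subset[OF Y_sub(3)[OF that] lower_limit_subseq[OF obj_lower[OF that] r]])
           (use LIMSEQ_subseq_LIMSEQ[OF obj_pt[OF that] r] in \<open>simp add: comp_def\<close>)
      then show ?thesis by (simp only: W_r)
    qed
    moreover have "argmin_on (Y x \<xi>) (bellman_obj \<beta> \<phi> V x \<xi>) \<noteq> {}" if "x \<in> X" "\<xi> \<in> \<Xi>" for x \<xi>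
      by (rule argmin_on_nonempty[OF Y_sub(3,2)[OF that] obj_lower[OF that] obj_pt[OF that]])
    ultimately show ?thesis by blast
  qed
  have part2: "LimOut (\<lambda>\<nu>. argmin_on (Y x \<xi>) (bellman_obj \<beta> (\<phi>s \<nu>) (Vs \<nu>) x \<xi>))
          \<subseteq> argmin_on (Y x \<xi>) (bellman_obj \<beta> \<phi> V x \<xi>) \<and>
        argmin_on (Y x \<xi>) (bellman_obj \<beta> \<phi> V x \<xi>) \<noteq> {}"
    if unique: "\<And>V'. V' \<in> \<V> \<Longrightarrow> aw_dist X zctr V' (bellman X P \<beta> \<phi> Y V') = 0 \<Longrightarrow> V' = V"
      and x: "x \<in> X" and \<xi>: "\<xi> \<in> \<Xi>" for V x \<xi>
  proof -
    have sub: "\<exists>t. strict_mono t \<and> epi_conv X (\<lambda>k. Vs (s (t k))) V \<and> V \<in> fcns X"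
      if s: "strict_mono (s :: nat \<Rightarrow> nat)" for s
    proof -
      obtain t V' where t: "strict_mono t" and V': "V' \<in> \<V>"
        and epi: "epi_conv X (\<lambda>k. Vs (s (t k))) V'"
        using AW.compact_imp_epi_conv_subseq[OF V_compact, of "\<lambda>k. Vs (s k)"] Vs_in by blast
      have "strict_mono (\<lambda>k. s (t k))" using strict_mono_o[OF s t] by (simp add: comp_def)
      from part1[OF this lsc(3)[OF V'] epi] have "V' = bellman X P \<beta> \<phi> Y V'" by blast
      then have "aw_dist X zctr V' (bellman X P \<beta> \<phi> Y V') = 0" using AW.aw_dist_self by metis
      then have "V' = V" by (rule unique[OF V'])
      then show ?thesis using t epi lsc(3)[OF V'] by blast
    qed
    have "LimOut (\<lambda>\<nu>. argmin_on (Y x \<xi>) (bellman_obj \<beta> (\<phi>s \<nu>) (Vs \<nu>) x \<xi>))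
          \<subseteq> argmin_on (Y x \<xi>) (bellman_obj \<beta> \<phi> V x \<xi>)"
    proof
      fix z assume "z \<in> LimOut (\<lambda>\<nu>. argmin_on (Y x \<xi>) (bellman_obj \<beta> (\<phi>s \<nu>) (Vs \<nu>) x \<xi>))"
      then obtain s w where s: "strict_mono (s :: nat \<Rightarrow> nat)"
        and w: "\<And>k. w k \<in> argmin_on (Y x \<xi>) (bellman_obj \<beta> (\<phi>s (s k)) (Vs (s k)) x \<xi>)"
        and lim: "w \<longlonglongrightarrow> z"
        unfolding LimOut_def by blast
      obtain t where t: "strict_mono t" and epi: "epi_conv X (\<lambda>k. Vs (s (t k))) V" and V: "V \<in> fcns X"
        using sub[OF s] by blast
      have st: "strict_mono (\<lambda>k. s (t k))" using strict_mono_o[OF s t] by (simp add: comp_def)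
      have "z \<in> LimOut (\<lambda>k. argmin_on (Y x \<xi>) (bellman_obj \<beta> (\<phi>s (s (t k))) (Vs (s (t k))) x \<xi>))"
        unfolding LimOut_def
        using w LIMSEQ_subseq_LIMSEQ[OF lim t]
        by (intro CollectI exI[of _ "\<lambda>k::nat. k"] exI[of _ "w \<circ> t"]) (auto simp: strict_mono_def)
      then show "z \<in> argmin_on (Y x \<xi>) (bellman_obj \<beta> \<phi> V x \<xi>)"
        using part1[OF st V epi] x \<xi> by blast
    qed
    moreover obtain t where t: "strict_mono (t :: nat \<Rightarrow> nat)" "epi_conv X (\<lambda>k. Vs (t k)) V" "V \<in> fcns X"
      using sub[of "\<lambda>k. k"] by (auto simp: strict_mono_def)
    ultimately show ?thesis using part1[OF t(1,3,2)] x \<xi> by blast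
  qed
  show ?thesis
  proof (intro conjI allI impI ballI; (elim conjE)?)
    fix r V assume r: "strict_mono r" and V: "V \<in> fcns X" and epi: "epi_conv X (\<lambda>k. Vs (r k)) V"
    note p = part1[OF r V epi]
    show "aw_dist X zctr V (bellman X P \<beta> \<phi> Y V) = 0"
      using p AW.aw_dist_self by metis
    fix x \<xi> assume "x \<in> X" "\<xi> \<in> \<Xi>"
    with p show "LimOut (\<lambda>k. argmin_on (Y x \<xi>) (bellman_obj \<beta> (\<phi>s (r k)) (Vs (r k)) x \<xi>))
          \<subseteq> argmin_on (Y x \<xi>) (bellman_obj \<beta> \<phi> V x \<xi>)"
        "argmin_on (Y x \<xi>) (bellman_obj \<beta> \<phi> V x \<xi>) \<noteq> {}" by blast+
  next
    fix V x \<xi>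
    assume "\<forall>V'\<in>\<V>. aw_dist X zctr V' (bellman X P \<beta> \<phi> Y V') = 0 \<longrightarrow> V' = V" "x \<in> X" "\<xi> \<in> \<Xi>"
    then show "LimOut (\<lambda>\<nu>. argmin_on (Y x \<xi>) (bellman_obj \<beta> (\<phi>s \<nu>) (Vs \<nu>) x \<xi>))
          \<subseteq> argmin_on (Y x \<xi>) (bellman_obj \<beta> \<phi> V x \<xi>)"
        "argmin_on (Y x \<xi>) (bellman_obj \<beta> \<phi> V x \<xi>) \<noteq> {}"
      using part2[of V x \<xi>] by blast+
  qed
qed

end
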